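(* Suppose MR combining based on the LMMSE estimator is used, i.e. $v_{m,k}=\hat h^{\mathrm{lmmse}}_{m,k}$ for all $m,k$. Fix a UE $k$ and a nonzero LSFD vector $\mathbf a_k=[\alpha_{1,k},\dots,\alpha_{M,k}]^T\in\mathbb C^M$, and put $\mathbf A_k=\mathrm{diag}(\alpha_{1,k},\dots,\alpha_{M,k})$. Then $\mathrm{SE}^{\mathrm{ul}}_k=\frac{\tau_u}{\tau_c}\log_2(1+\gamma^{\mathrm{ul,lmmse}}_k)$ with $$\gamma^{\mathrm{ul,lmmse}}_k=\frac{p_k\hat p_k^2\tau_p^2|\mathrm{tr}(\mathbf A_k\boldsymbol\Omega'_k)|^2}{\sum_{l=1}^K p_lT^{(1)}_{k,l}+\sum_{l\in\mathcal P_k}p_lT^{(2)}_{k,l}-p_k\hat p_k^2\tau_p^2|\mathrm{tr}(\mathbf A_k\boldsymbol\Omega'_k)|^2+\sigma^2_{\mathrm{ul}}\hat p_k\tau_p\mathrm{tr}(\mathbf A_k^H\boldsymbol\Omega'_k\mathbf A_k)},$$ where $T^{(1)}_{k,l}=\hat p_k\tau_p\,\mathrm{tr}(\mathbf A_k^H\mathbf R'_l\boldsymbol\Omega'_k\mathbf A_k)$ and $$T^{(2)}_{k,l}=\hat p_k\hat p_l\tau_p^2\Big[\mathrm{tr}(\mathbf A_k^H\mathbf R_l^2\boldsymbol\Lambda'_k\boldsymbol\Omega'_k\mathbf A_k)+|\mathrm{tr}(\mathbf A_k\mathbf R'_l\boldsymbol\Lambda'_k\mathbf R'_k)|^2+2\,\mathrm{tr}(\mathbf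 A_k^H\boldsymbol\Lambda'_k\boldsymbol\Omega'_k\mathbf L_l\mathbf R_l\mathbf A_k)-\mathrm{tr}\big(\mathbf A_k^H(\mathbf R'_l\boldsymbol\Lambda'_k\mathbf R'_k)^2\mathbf A_k\big)\Big].$$ Equivalently, in Rayleigh quotient form, $$\gamma^{\mathrm{ul,lmmse}}_k=\frac{p_k\,\mathbf a_k^H\mathbf b^{\mathrm{lmmse}}_k(\mathbf b^{\mathrm{lmmse}}_k)^H\mathbf a_k}{\mathbf a_k^H\boldsymbol\Gamma^{\mathrm{lmmse}}_k\mathbf a_k},$$ $$\boldsymbol\Gamma^{\mathrm{lmmse}}_k=\sum_{l=1}^K p_l\boldsymbol\Gamma^{(1)}_{k,l}+\sum_{l\in\mathcal P_k}p_l\boldsymbol\Gamma^{(2)}_{k,l}-p_k\mathbf b^{\mathrm{lmmse}}_k(\mathbf b^{\mathrm{lmmse}}_k)^H+\hat p_k\tau_p\sigma^2_{\mathrm{ul}}\boldsymbol\Omega'_k,$$ where $\mathbf b^{\mathrm{lmmse}}_k=\hat p_k\tau_p\,\mathrm{diag}(\boldsymbol\Omega'_k)$, $\boldsymbol\Gamma^{(1)}_{k,l}=\hat p_k\tau_p\mathbf R'_l\boldsymbol\Omega'_k$, $\mathbf d_{k,l}=\mathrm{diag}(\mathbf R'_l\boldsymbol\Lambda'_k\mathbf R'_k)$ and $$\boldsymbol\Gamma^{(2)}_{k,l}=\hat p_k\hat p_l\tau_p^2\big[\mathbf R_l^2\boldsymbol\Lambda'_k\boldsymbol\Omega'_k+2\boldsymbol\Lambda'_k\boldsymbol\Omega'_k\mathbf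 L_l\mathbf R_l+\mathbf d_{k,l}\mathbf d_{k,l}^H-(\mathbf R'_l\boldsymbol\Lambda'_k\mathbf R'_k)^2\big].$$ The LSFD vector $\mathbf a_k=(\boldsymbol\Gamma^{\mathrm{lmmse}}_k)^{-1}\mathbf b^{\mathrm{lmmse}}_k$ maximizes $\mathrm{SE}^{\mathrm{ul}}_k$ over $\mathbf a_k$, and with this vector $$\mathrm{SE}^{\mathrm{ul}}_k=\frac{\tau_u}{\tau_c}\log_2\left(1+p_k(\mathbf b^{\mathrm{lmmse}}_k)^H(\boldsymbol\Gamma^{\mathrm{lmmse}}_k)^{-1}\mathbf b^{\mathrm{lmmse}}_k\right).$$
   Context: Channels. There are $M$ single-antenna access points (APs) and $K$ single-antenna users (UEs). The channel between AP $m$ and UE $k$ is $h_{m,k}=\bar h_{m,k}e^{j\varphi_{m,k}}+g_{m,k}$, with $\bar h_{m,k}\ge 0$ deterministic, $\varphi_{m,k}$ uniform on $[-\pi,\pi]$, $g_{m,k}\sim\mathcal N_{\mathbb C}(0,\beta_{m,k})$ (circularly symmetric complex Gaussian), $\beta_{m,k}>0$; all $\varphi_{m,k},g_{m,k}$ are mutually independent over $m,k$. Write $\mathbf h_k=[h_{1,k},\dots,h_{M,k}]^T$. Pilots. $\tau_c$ is the coherence block length, $\tau_p<K$ the pilot length, $\tau_u\le\tau_c-\tau_p$ the number of uplink data symbols. Each UE uses one of $\tau_p$ mutually orthogonal pilot sequences $\boldsymbol\phi_k\in\mathbb C^{\tau_p}$ with $\|\boldsymbol\phi_k\|^2=\tau_p$,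 with pilot power $\hat p_k>0$. $\mathcal P_k$ is the set of UEs using the same pilot as UE $k$ (including $k$). After correlation with the pilot, AP $m$ has $$y^p_{m,k}=\sum_{l\in\mathcal P_k}\sqrt{\hat p_l}\,\tau_p h_{m,l}+\boldsymbol\phi_k^H\mathbf n^p_m,$$ where the $\mathbf n^p_m\sim\mathcal N_{\mathbb C}(\mathbf 0,\sigma^2_{\mathrm{ul}}\mathbf I_{\tau_p})$ are independent over $m$ and independent of all channels, and $\sigma^2_{\mathrm{ul}}>0$. LMMSE estimator (phases unknown): $\hat h^{\mathrm{lmmse}}_{m,k}=\sqrt{\hat p_k}\,\beta'_{m,k}y^p_{m,k}/\lambda'_{m,k}$, with $\beta'_{m,k}=\beta_{m,k}+\bar h_{m,k}^2$ and $\lambda'_{m,k}=\sum_{l\in\mathcal P_k}\hat p_l\tau_p\beta'_{m,l}+\sigma^2_{\mathrm{ul}}$. Matrices (all $M\times M$ diagonal): $\mathbf R_k=\mathrm{diag}(\beta_{1,k},\dots,\beta_{M,k})$, $\mathbf L_k=\mathrm{diag}(\bar h_{1,k}^2,\dots,\bar h_{M,k}^2)$, $\mathbf R'_k=\mathbf R_k+\mathbf L_k$, $\boldsymbol\Lambda'_k=\mathrm{diag}(\lambda'_{1,k},\dots,\lambda'_{M,k})^{-1}$, $\boldsymbol\Omega'_k=\mathbf R'_k\boldsymbol\Lambda'_k\mathbf R'_k$. For a diagonal matrix $\mathbf D$, $\mathrm{diag}(\mathbf D)$ is the column vector of its diagonal entries. Uplink spectral efficiency. UE $k$ transmits data with power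 $p_k\ge 0$. With combining vector $\mathbf v_k=[v_{1,k},\dots,v_{M,k}]^T$ and deterministic LSFD (large-scale fading decoding) coefficients $\alpha_{m,k}\in\mathbb C$, the (use-and-then-forget) uplink SE of UE $k$ is defined as $\mathrm{SE}^{\mathrm{ul}}_k=\frac{\tau_u}{\tau_c}\log_2(1+\gamma^{\mathrm{ul}}_k)$ with $$\gamma^{\mathrm{ul}}_k=\frac{p_k|\mathbb E\{\mathbf v_k^H\mathbf A_k^H\mathbf h_k\}|^2}{\sum_{l=1}^K p_l\mathbb E\{|\mathbf v_k^H\mathbf A_k^H\mathbf h_l|^2\}-p_k|\mathbb E\{\mathbf v_k^H\mathbf A_k^H\mathbf h_k\}|^2+\sigma^2_{\mathrm{ul}}\mathbb E\{\|\mathbf A_k\mathbf v_k\|^2\}},$$ expectations being over all randomness. *)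

theory Defs
  imports "HOL-Probability.Probability"
begin

section \<open>Complex vectors and matrices\<close>

definition cdot :: "complex^'n \<Rightarrow> complex^'n \<Rightarrow> complex" where
  "cdot x y = (\<Sum>i\<in>UNIV. cnj (x $ i) * y $ i)"  \<comment> \<open>\<open>x\<^sup>H y\<close>, conjugate-linear in \<open>x\<close>\<close>

definition hermitian :: "complex^'n^'m \<Rightarrow> complex^'m^'n" where
  "hermitian A = (\<chi> i j. cnj (A $ j $ i))"

definition outer :: "complex^'m \<Rightarrow> complex^'n \<Rightarrow> complex^'n^'m" where
  "outer x y = (\<chi> i j. x $ i * cnj (y $ j))"  \<comment> \<open>\<open>x y\<^sup>H\<close>\<close>

definition diag_mat :: "complex^'n \<Rightarrow> complex^'n^'n" where
  "diag_mat x = (\<chi> i j. if i = j then x $ i else 0)"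

definition diag_vec :: "complex^'n^'n \<Rightarrow> complex^'n" where
  "diag_vec D = (\<chi> i. D $ i $ i)"


section \<open>System model\<close>

text \<open>
  The law \<open>\<N>\<^sub>\<complex>(0, v)\<close>, \<open>v > 0\<close>: independent real and imaginary parts, each
  \<open>\<N>(0, v/2)\<close>; the second argument of \<^const>\<open>normal_density\<close> is the standard deviation.
\<close>

definition complex_normal :: "'w measure \<Rightarrow> ('w \<Rightarrow> complex) \<Rightarrow> real \<Rightarrow> bool" where
  "complex_normal P X v \<longleftrightarrow>
     distributed P lborel (\<lambda>w. Re (X w)) (normal_density 0 (sqrt (v / 2))) \<and>
     distributed P lborel (\<lambda>w. Im (X w)) (normal_density 0 (sqrt (v / 2))) \<and>
     prob_space.indep_var P borel (\<lambda>w. Re (X w)) borel (\<lambda>w. Im (X w))"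

text \<open>
  The index types \<open>'m\<close>, \<open>'k\<close> and \<open>'t\<close> enumerate the \<open>M\<close> access points, the \<open>K\<close> users and
  the \<open>\<tau>\<^sub>p\<close> coordinates of a pilot sequence. As there are also exactly \<open>\<tau>\<^sub>p\<close> pilot sequences,
  \<open>'t\<close> serves to label them, too: \<open>pilot_seq s\<close> is the sequence with label \<open>s\<close>, and user \<open>k\<close>
  transmits the sequence labelled \<open>pilot_of k\<close>. The unconstrained type \<open>'w\<close> is the sample space.
\<close>

record ('m, 'k, 't::finite, 'w) uplink =
  outcomes :: "'w measure"
  hbar :: "'m \<Rightarrow> 'k \<Rightarrow> real"
  beta :: "'m \<Rightarrow> 'k \<Rightarrow> real"
  phase :: "'m \<Rightarrow> 'k \<Rightarrow> 'w \<Rightarrow> real"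
  scatter :: "'m \<Rightarrow> 'k \<Rightarrow> 'w \<Rightarrow> complex"
  pilot_noise :: "'m \<Rightarrow> 'w \<Rightarrow> complex^'t"
  pilot_seq :: "'t \<Rightarrow> complex^'t"
  pilot_of :: "'k \<Rightarrow> 't"
  pilot_power :: "'k \<Rightarrow> real"
  data_power :: "'k \<Rightarrow> real"
  sigma2 :: real  \<comment> \<open>the noise variance \<open>\<sigma>\<^sup>2\<^sub>u\<^sub>l\<close>\<close>
  tau_c :: nat
  tau_u :: nat

definition tau_p :: "('m, 'k, 't::finite, 'w) uplink \<Rightarrow> real" where
  "tau_p S = real CARD('t)"

datatype ('m, 'k, 't) source = Phase 'm 'k | Scatter 'm 'k | Noise 'm 't

text \<open>
  All elementary random variables as one complex-valued family; the real phases are embedded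
  by \<^const>\<open>complex_of_real\<close>, which does not change the generated sigma-algebras.
\<close>

definition source_var ::
    "('m, 'k, 't::finite, 'w) uplink \<Rightarrow> ('m, 'k, 't) source \<Rightarrow> 'w \<Rightarrow> complex" where
  "source_var S s w = (case s of
       Phase m k \<Rightarrow> complex_of_real (phase S m k w)
     | Scatter m k \<Rightarrow> scatter S m k w
     | Noise m i \<Rightarrow> pilot_noise S m w $ i)"

text \<open>
  Mutual independence of the whole family, noise coordinates included, expresses at once that
  each noise vector has law \<open>\<N>\<^sub>\<complex>(0, \<sigma>\<^sup>2 I)\<close>, that the noise vectors are independent over the
  access points and of all channels, and that all phases and scattered components are mutually
  independent.
\<close>

locale uplink_model = prob_space "outcomes S"
  for S :: "('m::finite, 'k::finite, 't::finite, 'w) uplink" +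
  assumes hbar_nonneg: "\<And>m k. hbar S m k \<ge> 0"
    and beta_pos: "\<And>m k. beta S m k > 0"
    and pilot_power_pos: "\<And>k. pilot_power S k > 0"
    and data_power_nonneg: "\<And>k. data_power S k \<ge> 0"
    and sigma2_pos: "sigma2 S > 0"
    and few_pilots: "CARD('t) < CARD('k)"
    and block_length: "tau_u S + CARD('t) \<le> tau_c S"
    and pilots_orthogonal: "\<And>s t. s \<noteq> t \<Longrightarrow> cdot (pilot_seq S s) (pilot_seq S t) = 0"
    and pilots_norm: "\<And>s. (norm (pilot_seq S s))\<^sup>2 = tau_p S"
    and phase_uniform: "\<And>m k. distributed (outcomes S) lborel (phase S m k)
          (\<lambda>x. indicator {-pi..pi} x / measure lborel {-pi..pi})"
    and scatter_normal: "\<And>m k. complex_normal (outcomes S) (scatter S m k) (beta S m k)"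
    and noise_normal: "\<And>m i. complex_normal (outcomes S) (\<lambda>w. pilot_noise S m w $ i) (sigma2 S)"
    and sources_indep: "indep_vars (\<lambda>_. borel) (source_var S) UNIV"

definition channel ::
    "('m::finite, 'k, 't::finite, 'w) uplink \<Rightarrow> 'k \<Rightarrow> 'w \<Rightarrow> complex^'m" where
  "channel S k w =
     (\<chi> m. complex_of_real (hbar S m k) * exp (\<i> * complex_of_real (phase S m k w))
           + scatter S m k w)"

definition copilot :: "('m, 'k, 't::finite, 'w) uplink \<Rightarrow> 'k \<Rightarrow> 'k set" where
  "copilot S k = {l. pilot_of S l = pilot_of S k}"

definition pilot_obs ::
    "('m::finite, 'k::finite, 't::finite, 'w) uplink \<Rightarrow> 'm \<Rightarrow> 'k \<Rightarrow> 'w \<Rightarrow> complex" where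
  "pilot_obs S m k w =
     (\<Sum>l\<in>copilot S k. complex_of_real (sqrt (pilot_power S l) * tau_p S) * channel S l w $ m)
     + cdot (pilot_seq S (pilot_of S k)) (pilot_noise S m w)"


section \<open>LMMSE estimate\<close>

definition beta' :: "('m, 'k, 't::finite, 'w) uplink \<Rightarrow> 'm \<Rightarrow> 'k \<Rightarrow> real" where
  "beta' S m k = beta S m k + (hbar S m k)\<^sup>2"

definition lambda' :: "('m, 'k::finite, 't::finite, 'w) uplink \<Rightarrow> 'm \<Rightarrow> 'k \<Rightarrow> real" where
  "lambda' S m k = (\<Sum>l\<in>copilot S k. pilot_power S l * tau_p S * beta' S m l) + sigma2 S"

definition lmmse ::
    "('m::finite, 'k::finite, 't::finite, 'w) uplink \<Rightarrow> 'k \<Rightarrow> 'w \<Rightarrow> complex^'m" where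
  "lmmse S k w =
     (\<chi> m. complex_of_real (sqrt (pilot_power S k) * beta' S m k / lambda' S m k)
           * pilot_obs S m k w)"


section \<open>Uplink spectral efficiency\<close>

text \<open>
  Here \<open>v\<close> is the random combining vector of user \<open>k\<close> and \<open>a\<close> its LSFD vector, so that
  \<open>diag_mat a\<close> is \<open>A\<^sub>k\<close>.
\<close>

definition ul_sinr ::
    "('m::finite, 'k::finite, 't::finite, 'w) uplink \<Rightarrow> ('w \<Rightarrow> complex^'m) \<Rightarrow> 'k \<Rightarrow> complex^'m \<Rightarrow> real"
where
  "ul_sinr S v k a =
     data_power S k
       * (cmod (\<integral>w. cdot (v w) (hermitian (diag_mat a) *v channel S k w) \<partial>outcomes S))\<^sup>2
     / ((\<Sum>l\<in>UNIV. data_power S l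
           * (\<integral>w. (cmod (cdot (v w) (hermitian (diag_mat a) *v channel S l w)))\<^sup>2 \<partial>outcomes S))
        - data_power S k
           * (cmod (\<integral>w. cdot (v w) (hermitian (diag_mat a) *v channel S k w) \<partial>outcomes S))\<^sup>2
        + sigma2 S * (\<integral>w. (norm (diag_mat a *v v w))\<^sup>2 \<partial>outcomes S))"

definition ul_se ::
    "('m::finite, 'k::finite, 't::finite, 'w) uplink \<Rightarrow> ('w \<Rightarrow> complex^'m) \<Rightarrow> 'k \<Rightarrow> complex^'m \<Rightarrow> real"
where
  "ul_se S v k a = real (tau_u S) / real (tau_c S) * log 2 (1 + ul_sinr S v k a)"


section \<open>Closed-form quantities\<close>

definition matR :: "('m::finite, 'k, 't::finite, 'w) uplink \<Rightarrow> 'k \<Rightarrow> complex^'m^'m" where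
  "matR S k = diag_mat (\<chi> m. complex_of_real (beta S m k))"

definition matL :: "('m::finite, 'k, 't::finite, 'w) uplink \<Rightarrow> 'k \<Rightarrow> complex^'m^'m" where
  "matL S k = diag_mat (\<chi> m. complex_of_real ((hbar S m k)\<^sup>2))"

definition matR' :: "('m::finite, 'k, 't::finite, 'w) uplink \<Rightarrow> 'k \<Rightarrow> complex^'m^'m" where
  "matR' S k = matR S k + matL S k"

definition Lambda' ::
    "('m::finite, 'k::finite, 't::finite, 'w) uplink \<Rightarrow> 'k \<Rightarrow> complex^'m^'m" where
  "Lambda' S k = matrix_inv (diag_mat (\<chi> m. complex_of_real (lambda' S m k)))"

definition Omega' ::
    "('m::finite, 'k::finite, 't::finite, 'w) uplink \<Rightarrow> 'k \<Rightarrow> complex^'m^'m" where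
  "Omega' S k = matR' S k ** Lambda' S k ** matR' S k"

text \<open>
  The quantities below are complex because the traces and quadratic forms are; that the SINR
  expressions built from them are real is part of the claim.
\<close>

definition T1 ::
    "('m::finite, 'k::finite, 't::finite, 'w) uplink \<Rightarrow> 'k \<Rightarrow> 'k \<Rightarrow> complex^'m \<Rightarrow> complex" where
  "T1 S k l a = (let A = diag_mat a in
     complex_of_real (pilot_power S k * tau_p S)
       * trace (hermitian A ** matR' S l ** Omega' S k ** A))"

definition T2 ::
    "('m::finite, 'k::finite, 't::finite, 'w) uplink \<Rightarrow> 'k \<Rightarrow> 'k \<Rightarrow> complex^'m \<Rightarrow> complex" where
  "T2 S k l a =
    (let A = diag_mat a; D = matR' S l ** Lambda' S k ** matR' S k in
     complex_of_real (pilot_power S k * pilot_power S l * (tau_p S)\<^sup>2)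
       * (trace (hermitian A ** (matR S l ** matR S l) ** Lambda' S k ** Omega' S k ** A)
          + complex_of_real ((cmod (trace (A ** D)))\<^sup>2)
          + 2 * trace (hermitian A ** Lambda' S k ** Omega' S k ** matL S l ** matR S l ** A)
          - trace (hermitian A ** (D ** D) ** A)))"

definition gamma_num ::
    "('m::finite, 'k::finite, 't::finite, 'w) uplink \<Rightarrow> 'k \<Rightarrow> complex^'m \<Rightarrow> complex" where
  "gamma_num S k a =
     complex_of_real (data_power S k * (pilot_power S k)\<^sup>2 * (tau_p S)\<^sup>2
       * (cmod (trace (diag_mat a ** Omega' S k)))\<^sup>2)"

definition gamma_den ::
    "('m::finite, 'k::finite, 't::finite, 'w) uplink \<Rightarrow> 'k \<Rightarrow> complex^'m \<Rightarrow> complex" where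
  "gamma_den S k a =
     (\<Sum>l\<in>UNIV. complex_of_real (data_power S l) * T1 S k l a)
     + (\<Sum>l\<in>copilot S k. complex_of_real (data_power S l) * T2 S k l a)
     - gamma_num S k a
     + complex_of_real (sigma2 S * pilot_power S k * tau_p S)
         * trace (hermitian (diag_mat a) ** Omega' S k ** diag_mat a)"

definition gamma_lmmse ::
    "('m::finite, 'k::finite, 't::finite, 'w) uplink \<Rightarrow> 'k \<Rightarrow> complex^'m \<Rightarrow> complex" where
  "gamma_lmmse S k a = gamma_num S k a / gamma_den S k a"

definition b_lmmse ::
    "('m::finite, 'k::finite, 't::finite, 'w) uplink \<Rightarrow> 'k \<Rightarrow> complex^'m" where
  "b_lmmse S k = (pilot_power S k * tau_p S) *\<^sub>R diag_vec (Omega' S k)"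

definition Gamma1 ::
    "('m::finite, 'k::finite, 't::finite, 'w) uplink \<Rightarrow> 'k \<Rightarrow> 'k \<Rightarrow> complex^'m^'m" where
  "Gamma1 S k l = (pilot_power S k * tau_p S) *\<^sub>R (matR' S l ** Omega' S k)"

definition Gamma2 ::
    "('m::finite, 'k::finite, 't::finite, 'w) uplink \<Rightarrow> 'k \<Rightarrow> 'k \<Rightarrow> complex^'m^'m" where
  "Gamma2 S k l =
    (let D = matR' S l ** Lambda' S k ** matR' S k; d = diag_vec D in
     (pilot_power S k * pilot_power S l * (tau_p S)\<^sup>2) *\<^sub>R
       (matR S l ** matR S l ** Lambda' S k ** Omega' S k
        + 2 *\<^sub>R (Lambda' S k ** Omega' S k ** matL S l ** matR S l)
        + outer d d
        - D ** D))"

definition Gamma_lmmse ::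
    "('m::finite, 'k::finite, 't::finite, 'w) uplink \<Rightarrow> 'k \<Rightarrow> complex^'m^'m" where
  "Gamma_lmmse S k =
     (\<Sum>l\<in>UNIV. data_power S l *\<^sub>R Gamma1 S k l)
     + (\<Sum>l\<in>copilot S k. data_power S l *\<^sub>R Gamma2 S k l)
     - data_power S k *\<^sub>R outer (b_lmmse S k) (b_lmmse S k)
     + (pilot_power S k * tau_p S * sigma2 S) *\<^sub>R Omega' S k"

end

theory Submission
  imports Defs
begin

text \<open>
  Write the pilot observation at access point \<open>m\<close> as \<open>y = s h + r\<close>, where \<open>h\<close> is the channel of the
  user \<open>l\<close> under consideration, \<open>s\<close> is its pilot gain (zero for a user with another pilot) and
  \<open>r\<close> is independent of \<open>h\<close> with mean zero. Then \<open>E[cnj y h]\<close> and \<open>E|y h|\<^sup>2\<close> involve only the second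
  and fourth absolute moments of \<open>h\<close> and the variance of \<open>r\<close>, for pilot-sharing and other users alike.
  The products \<open>cnj y h\<close> are independent over the access points, so the second moment of their
  LSFD combination is the squared modulus of its mean plus the weighted sum of the variances.
  Since a second moment dominates the squared modulus of the mean, the denominator is bounded below
  by the noise term; hence \<open>\<Gamma>\<close> is Hermitian positive definite, and the Cauchy-Schwarz inequality for
  the form it defines gives the maximizer of the Rayleigh quotient.
\<close>

section \<open>Moments of independent complex random variables\<close>

lemma borel_measurable_cnj [measurable]: "cnj \<in> borel_measurable borel"
  by (intro borel_measurable_continuous_onI continuous_intros)

text \<open>Restrictions of an independent family to disjoint index sets are independent. The
  locality assumptions say that \<open>F\<close> and \<open>G\<close> read only their own block, so
  they can be applied to the whole configuration and the restrictions disappear from the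
  conclusion.\<close>

lemma (in prob_space) indep_var_blocks:
  assumes X: "indep_vars (\<lambda>_. borel) X UNIV" and disj: "A \<inter> B = {}"
    and F: "F \<in> borel_measurable (PiM A (\<lambda>_. borel))" and G: "G \<in> borel_measurable (PiM B (\<lambda>_. borel))"
    and F_local: "\<And>x. F (restrict x A) = F x" and G_local: "\<And>x. G (restrict x B) = G x"
  shows "indep_var borel (\<lambda>w. F (\<lambda>i. X i w)) borel (\<lambda>w. G (\<lambda>i. X i w))"
proof -
  have "indep_var borel (F \<circ> (\<lambda>w. restrict (\<lambda>i. X i w) A)) borel (G \<circ> (\<lambda>w. restrict (\<lambda>i. X i w) B))"
    by (rule indep_var_compose[OF indep_var_restrict[OF X disj] F G]) auto
  then show ?thesis
    by (simp add: o_def F_local G_local)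
qed

text \<open>Stating every moment with \<open>has_bochner_integral\<close> carries integrability and
  value together; independence transfers both to the product.\<close>

lemma (in prob_space) indep_var_has_bochner_integral_mult:
  fixes X Y :: "'a \<Rightarrow> complex"
  assumes "indep_var borel X borel Y" "has_bochner_integral M X x" "has_bochner_integral M Y y"
  shows "has_bochner_integral M (\<lambda>w. X w * Y w) (x * y)"
  using assms indep_var_integrable[of X Y] indep_var_lebesgue_integral[of X Y]
  by (simp add: has_bochner_integral_iff)

lemma (in prob_space) indep_var_compose_borel:
  fixes X Y :: "'a \<Rightarrow> complex"
  assumes "indep_var borel X borel Y" "f \<in> borel_measurable borel" "g \<in> borel_measurable borel"
  shows "indep_var borel (\<lambda>w. f (X w) :: complex) borel (\<lambda>w. g (Y w) :: complex)"
  using indep_var_compose[OF assms] by (simp add: o_def)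

text \<open>Second moments are computed in the form \<open>X * cnj X\<close>, where ring algebra
  applies; this passes between them and the real integrals of squared moduli.\<close>

lemma has_bochner_integral_of_real_iff:
  "has_bochner_integral M (\<lambda>w. complex_of_real (f w)) (complex_of_real x)
     \<longleftrightarrow> has_bochner_integral M f x"
  by (auto simp: has_bochner_integral_iff complex_of_real_integrable_eq)

text \<open>Serves two situations: uncorrelated observables at one access point, where the
  off-diagonal \<open>C i j\<close> vanish, and products at different access points, where they
  factor into means.\<close>

lemma has_bochner_integral_sum_mult_cnj:
  fixes X :: "'i \<Rightarrow> 'w \<Rightarrow> complex"
  assumes "\<And>i j. i \<in> I \<Longrightarrow> j \<in> I \<Longrightarrow> has_bochner_integral M (\<lambda>w. X i w * cnj (X j w)) (C i j)"
  shows "has_bochner_integral M (\<lambda>w. (\<Sum>i\<in>I. c i * X i w) * cnj (\<Sum>i\<in>I. c i * X i w))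
    (\<Sum>i\<in>I. \<Sum>j\<in>I. c i * cnj (c j) * C i j)"
proof -
  have "has_bochner_integral M (\<lambda>w. \<Sum>i\<in>I. \<Sum>j\<in>I. c i * cnj (c j) * (X i w * cnj (X j w)))
    (\<Sum>i\<in>I. \<Sum>j\<in>I. c i * cnj (c j) * C i j)"
    by (intro has_bochner_integral_sum has_bochner_integral_mult_right assms)
  then show ?thesis
    by (simp add: sum_product ac_simps)
qed

section \<open>Moments of the uniform phase and of the complex Gaussian\<close>

lemma distributed_has_bochner_integral:
  fixes g :: "real \<Rightarrow> real"
  assumes "distributed M lborel X (\<lambda>x. ennreal (f x))" "\<And>x. 0 \<le> f x" "g \<in> borel_measurable borel"
    "has_bochner_integral lborel (\<lambda>x. f x * g x) y"
  shows "has_bochner_integral M (\<lambda>w. g (X w)) y"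
  using assms distributed_integrable[of M lborel X f g] distributed_integral[of M lborel X f g]
  by (auto simp: has_bochner_integral_iff)

text \<open>Cosine and sine integrate to zero over a full period, by their antiderivatives.\<close>

lemma (in prob_space) uniform_phase_mean:
  assumes "distributed M lborel X (\<lambda>x. ennreal (indicator {-pi..pi} x / measure lborel {-pi..pi}))"
  shows "has_bochner_integral M (\<lambda>w. exp (\<i> * complex_of_real (X w))) 0"
proof -
  have c: "has_bochner_integral M (\<lambda>w. cos (X w)) 0"
  proof (rule distributed_has_bochner_integral[OF assms])
    have "has_bochner_integral lborel (\<lambda>x. indicator {-pi..pi} x *\<^sub>R cos x) (sin pi - sin (-pi))"
      by (rule has_bochner_integral_FTC_Icc)
        (auto intro!: derivative_eq_intros continuous_intros simp: has_real_derivative_iff_has_vector_derivative[symmetric])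
    \<comment> \<open>Division by the interval length \<open>2 * pi\<close> turns the indicator into
      the uniform density.\<close>
    from has_bochner_integral_mult_left[OF this, of "1 / (2*pi)"]
    show "has_bochner_integral lborel (\<lambda>x. indicator {-pi..pi} x / measure lborel {-pi..pi} * cos x) 0"
      by (simp add: ac_simps)
  qed auto
  have s: "has_bochner_integral M (\<lambda>w. sin (X w)) 0"
  proof (rule distributed_has_bochner_integral[OF assms])
    have "has_bochner_integral lborel (\<lambda>x. indicator {-pi..pi} x *\<^sub>R sin x) (- cos pi - (- cos (-pi)))"
      by (rule has_bochner_integral_FTC_Icc)
        (auto intro!: derivative_eq_intros continuous_intros simp: has_real_derivative_iff_has_vector_derivative[symmetric])
    from has_bochner_integral_mult_left[OF this, of "1 / (2*pi)"]
    show "has_bochner_integral lborel (\<lambda>x. indicator {-pi..pi} x / measure lborel {-pi..pi} * sin x) 0"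
      by (simp add: ac_simps)
  qed auto
  have "has_bochner_integral M (\<lambda>w. complex_of_real (cos (X w)) + \<i> * complex_of_real (sin (X w)))
     (complex_of_real 0 + \<i> * complex_of_real 0)"
    by (intro has_bochner_integral_add has_bochner_integral_mult_right has_bochner_integral_of_real c s)
  then show ?thesis
    by (simp add: cis_conv_exp[symmetric] complex_eq_iff cis.ctr Complex_eq)
qed

text \<open>Real and imaginary part are independent with variance v/2. In the mean of
  \<open>X^2\<close> the equal variances cancel and the cross term vanishes, which is circular
  symmetry. The fourth moment is 3v^2/4 + 2(v/2)^2 + 3v^2/4.\<close>

lemma (in prob_space) complex_normal_moments:
  assumes "complex_normal M X v" and v: "v > 0"
  shows "has_bochner_integral M X 0"
    and "has_bochner_integral M (\<lambda>w. X w ^ 2) 0"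
    and "has_bochner_integral M (\<lambda>w. (cmod (X w))\<^sup>2) v"
    and "has_bochner_integral M (\<lambda>w. (cmod (X w)) ^ 4) (2 * v\<^sup>2)"
proof -
  define s where "s = sqrt (v / 2)"
  have s: "s > 0" and s2: "s\<^sup>2 = v / 2" using v by (auto simp: s_def)
  have "s ^ 4 = (s\<^sup>2)\<^sup>2" by simp
  then have s4: "s ^ 4 = v\<^sup>2 / 4"
    by (simp add: s2 power_divide)
  have D: "distributed M lborel (\<lambda>w. Re (X w)) (normal_density 0 s)"
    "distributed M lborel (\<lambda>w. Im (X w)) (normal_density 0 s)"
    and ind: "indep_var borel (\<lambda>w. Re (X w)) borel (\<lambda>w. Im (X w))"
    using assms unfolding complex_normal_def s_def by auto
  have m: "has_bochner_integral M Y 0" "has_bochner_integral M (\<lambda>w. (Y w)\<^sup>2) (v / 2)"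
       "has_bochner_integral M (\<lambda>w. (Y w) ^ 4) (3 * v\<^sup>2 / 4)"
    if Y: "distributed M lborel Y (normal_density 0 s)" for Y
  proof -
    note * = distributed_has_bochner_integral[OF Y normal_density_nonneg]
    show "has_bochner_integral M Y 0"
      using *[of "\<lambda>x. x"] normal_moment_nz_1[OF s, of 0] by simp
    \<comment> \<open>The last index given to \<open>normal_moment_even\<close> is half the order of
      the moment: 1 gives s^2 here, and 2 gives 3 s^4 below.\<close>
    show "has_bochner_integral M (\<lambda>w. (Y w)\<^sup>2) (v / 2)"
      using *[of "\<lambda>x. x\<^sup>2"] normal_moment_even[OF s, of 0 1] s s2 by (simp add: fact_numeral)
    show "has_bochner_integral M (\<lambda>w. (Y w) ^ 4) (3 * v\<^sup>2 / 4)"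
      using *[of "\<lambda>x. x ^ 4"] normal_moment_even[OF s, of 0 2] s s4 s2
      by (simp add: fact_numeral power_divide)
  qed
  note R = m[OF D(1)] and I = m[OF D(2)]
  have mult: "has_bochner_integral M (\<lambda>w. f (Re (X w)) * g (Im (X w))) (x * y)"
    if "has_bochner_integral M (\<lambda>w. f (Re (X w))) x" "has_bochner_integral M (\<lambda>w. g (Im (X w))) y"
      "f \<in> borel_measurable borel" "g \<in> borel_measurable borel" for f g :: "real \<Rightarrow> real" and x y
    using that indep_var_compose[OF ind that(3,4)]
      indep_var_integrable[of "\<lambda>w. f (Re (X w))" "\<lambda>w. g (Im (X w))"]
      indep_var_lebesgue_integral[of "\<lambda>w. f (Re (X w))" "\<lambda>w. g (Im (X w))"]
    by (simp add: has_bochner_integral_iff o_def)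
  have RI: "has_bochner_integral M (\<lambda>w. Re (X w) * Im (X w)) (0 * 0)"
    using mult[of "\<lambda>x. x" 0 "\<lambda>x. x" 0] R I by simp
  have R2I2: "has_bochner_integral M (\<lambda>w. (Re (X w))\<^sup>2 * (Im (X w))\<^sup>2) (v / 2 * (v / 2))"
    by (rule mult[of "\<lambda>x. x\<^sup>2" _ "\<lambda>x. x\<^sup>2", OF R(2) I(2)]) auto
  have "has_bochner_integral M (\<lambda>w. complex_of_real (Re (X w)) + \<i> * complex_of_real (Im (X w)))
     (complex_of_real 0 + \<i> * complex_of_real 0)"
    by (intro has_bochner_integral_add has_bochner_integral_mult_right has_bochner_integral_of_real R I)
  then show "has_bochner_integral M X 0"
    by (simp add: complex_eq[symmetric])
  have "has_bochner_integral M (\<lambda>w. complex_of_real ((Re (X w))\<^sup>2 - (Im (X w))\<^sup>2)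
        + 2 * \<i> * complex_of_real (Re (X w) * Im (X w)))
     (complex_of_real (v/2 - v/2) + 2 * \<i> * complex_of_real (0 * 0))"
    by (intro has_bochner_integral_add has_bochner_integral_mult_right has_bochner_integral_of_real
        has_bochner_integral_diff R I RI)
  moreover have "complex_of_real ((Re (X w))\<^sup>2 - (Im (X w))\<^sup>2)
        + 2 * \<i> * complex_of_real (Re (X w) * Im (X w)) = X w ^ 2" for w
    by (simp add: complex_eq_iff power2_eq_square)
  ultimately show "has_bochner_integral M (\<lambda>w. X w ^ 2) 0"
    by simp
  have "has_bochner_integral M (\<lambda>w. (Re (X w))\<^sup>2 + (Im (X w))\<^sup>2) (v / 2 + v / 2)"
    by (intro has_bochner_integral_add R I)
  then show "has_bochner_integral M (\<lambda>w. (cmod (X w))\<^sup>2) v"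
    by (simp add: cmod_power2)
  have "has_bochner_integral M (\<lambda>w. (Re (X w))^4 + 2 * ((Re (X w))\<^sup>2 * (Im (X w))\<^sup>2) + (Im (X w))^4)
     (3 * v\<^sup>2 / 4 + 2 * (v / 2 * (v / 2)) + 3 * v\<^sup>2 / 4)"
    by (intro has_bochner_integral_add has_bochner_integral_mult_right R I R2I2)
  moreover have "(cmod (X w)) ^ 4 = (Re (X w))^4 + 2 * ((Re (X w))\<^sup>2 * (Im (X w))\<^sup>2) + (Im (X w))^4" for w
  proof -
    have "(cmod (X w)) ^ 4 = ((cmod (X w))\<^sup>2)\<^sup>2" by (simp flip: power_mult)
    also have "\<dots> = ((Re (X w))\<^sup>2 + (Im (X w))\<^sup>2)\<^sup>2" by (simp only: cmod_power2)
    finally show ?thesis by (simp add: power2_eq_square power4_eq_xxxx algebra_simps)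
  qed
  ultimately show "has_bochner_integral M (\<lambda>w. (cmod (X w)) ^ 4) (2 * v\<^sup>2)"
    by (simp add: power2_eq_square)
qed

text \<open>The difference of the two sides is the mean of \<open>(cmod (X w - \<mu>))^2\<close>, as
  expanding the square shows.\<close>

lemma (in prob_space) second_moment_ge:
  fixes X :: "'a \<Rightarrow> complex"
  assumes X: "has_bochner_integral M X \<mu>" "has_bochner_integral M (\<lambda>w. (cmod (X w))\<^sup>2) q"
  shows "(cmod \<mu>)\<^sup>2 \<le> q"
proof -
  have const: "has_bochner_integral M (\<lambda>_. x) x" for x :: complex
    by (simp add: has_bochner_integral_iff prob_space)
  have "has_bochner_integral M
      (\<lambda>w. complex_of_real ((cmod (X w))\<^sup>2) - cnj \<mu> * X w - \<mu> * cnj (X w) + \<mu> * cnj \<mu>)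
      (complex_of_real q - cnj \<mu> * \<mu> - \<mu> * cnj \<mu> + \<mu> * cnj \<mu>)"
    by (intro has_bochner_integral_add has_bochner_integral_diff has_bochner_integral_mult_right
        has_bochner_integral_of_real has_bochner_integral_cnj const X)
  moreover have "complex_of_real ((cmod (X w))\<^sup>2) - cnj \<mu> * X w - \<mu> * cnj (X w) + \<mu> * cnj \<mu>
      = complex_of_real ((cmod (X w - \<mu>))\<^sup>2)" for w
    unfolding complex_norm_square by (simp add: algebra_simps)
  moreover have "complex_of_real q - cnj \<mu> * \<mu> - \<mu> * cnj \<mu> + \<mu> * cnj \<mu> = complex_of_real (q - (cmod \<mu>)\<^sup>2)"
    unfolding of_real_diff complex_norm_square by simp
  ultimately have "has_bochner_integral M (\<lambda>w. (cmod (X w - \<mu>))\<^sup>2) (q - (cmod \<mu>)\<^sup>2)"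
    by (simp only: has_bochner_integral_of_real_iff)
  from has_bochner_integral_integral_eq[OF this] show ?thesis
    by (metis (no_types, lifting) diff_ge_0_iff_ge integral_nonneg_AE AE_I2 zero_le_power2)
qed

text \<open>The cross terms of fourth-moment expansions contain the cube X|X|^2. It is dominated
  through t^3 \<le> t^2 + t^4, which is t^2 ((t - 1)^2 + t) \<ge> 0.\<close>

lemma integrable_mult_cnj_mult:
  fixes X :: "'w \<Rightarrow> complex"
  assumes X: "X \<in> borel_measurable M" "integrable M (\<lambda>w. (cmod (X w))\<^sup>2)" "integrable M (\<lambda>w. (cmod (X w)) ^ 4)"
  shows "integrable M (\<lambda>w. X w * cnj (X w) * X w)"
proof (rule Bochner_Integration.integrable_bound)
  show "integrable M (\<lambda>w. (cmod (X w))\<^sup>2 + (cmod (X w)) ^ 4)"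
    using X by auto
  have "t ^ 3 \<le> t\<^sup>2 + t ^ 4" if "t \<ge> 0" for t :: real
  proof -
    have "0 \<le> t\<^sup>2 * ((t - 1)\<^sup>2 + t)" using that by simp
    then show ?thesis by (simp add: power2_eq_square power3_eq_cube power4_eq_xxxx algebra_simps)
  qed
  then show "AE w in M. norm (X w * cnj (X w) * X w) \<le> norm ((cmod (X w))\<^sup>2 + (cmod (X w)) ^ 4)"
    by (auto simp: norm_mult power3_eq_cube)
  show "(\<lambda>w. X w * cnj (X w) * X w) \<in> borel_measurable M"
    using X(1) by measurable
qed

text \<open>Expand in \<open>u\<close>, \<open>g\<close> and their conjugates and reduce by |u| = 1.
  Terms linear in \<open>u\<close> or its conjugate vanish since \<open>u\<close> has mean zero,
  terms with u^2 or its conjugate since \<open>g^2\<close> has mean zero. What survives of the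
  fourth power is c^4 + 4c^2|g|^2 + |g|^4.\<close>

lemma (in prob_space) rician_moments:
  assumes ind: "indep_var borel u borel g" and u: "\<And>w. cmod (u w) = 1" "has_bochner_integral M u 0"
    and g: "complex_normal M g v" "v > 0"
  shows "has_bochner_integral M (\<lambda>w. complex_of_real c * u w + g w) 0" (is ?mean)
    and "has_bochner_integral M (\<lambda>w. (complex_of_real c * u w + g w) * cnj (complex_of_real c * u w + g w))
           (complex_of_real (v + c\<^sup>2))" (is ?second)
    and "has_bochner_integral M (\<lambda>w. (cmod (complex_of_real c * u w + g w)) ^ 4)
           ((v + c\<^sup>2)\<^sup>2 + v\<^sup>2 + 2 * c\<^sup>2 * v)" (is ?fourth)
proof -
  note gm = complex_normal_moments[OF g]
  have um: "u \<in> borel_measurable M" and gms: "g \<in> borel_measurable M"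
    using u(2) gm(1) by (auto simp: has_bochner_integral_iff)
  have uc: "u w * cnj (u w) = 1" for w
    using u(1)[of w] by (simp flip: complex_norm_square)
  have gc: "g w * cnj (g w) = complex_of_real ((cmod (g w))\<^sup>2)" for w
    by (rule complex_norm_square[symmetric])
  have ucn: "has_bochner_integral M (\<lambda>w. cnj (u w)) 0"
    using has_bochner_integral_cnj[OF u(2)] by simp
  have g3: "integrable M (\<lambda>w. g w * cnj (g w) * g w)"
    using gm gms by (intro integrable_mult_cnj_mult) (auto simp: has_bochner_integral_iff)
  have gint: "integrable M g" using gm(1) by (auto simp: has_bochner_integral_iff)
  \<comment> \<open>One statement for all cross terms: \<open>a = 1\<close>, \<open>b = 0\<close>
    occurs in the second moment, \<open>a = c^2\<close>, \<open>b = 1\<close> in the fourth.\<close>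
  have A: "has_bochner_integral M (\<lambda>w. u w * cnj (complex_of_real a * g w + complex_of_real b * (g w * cnj (g w) * g w))) 0"
     for a b
  proof -
    have i: "integrable M (\<lambda>w. cnj (complex_of_real a * g w + complex_of_real b * (g w * cnj (g w) * g w)))"
      using g3 gint by (intro integrable_cnj Bochner_Integration.integrable_add integrable_mult_right) auto
    have "indep_var borel u borel (\<lambda>w. cnj (complex_of_real a * g w + complex_of_real b * (g w * cnj (g w) * g w)))"
      by (rule indep_var_compose_borel[OF ind, of "\<lambda>x. x"]) auto
    from indep_var_has_bochner_integral_mult[OF this u(2) has_bochner_integral_integrable[OF i]]
    show ?thesis by simp
  qed
  have B: "has_bochner_integral M (\<lambda>w. cnj (u w) * (complex_of_real a * g w + complex_of_real b * (g w * cnj (g w) * g w))) 0"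
     for a b
    using has_bochner_integral_cnj[OF A[of a b]] by simp
  \<comment> \<open>Here the zero factor is the mean of \<open>g^2\<close>; the factor from
    \<open>u\<close> is bounded because |u| = 1, hence integrable.\<close>
  have C: "has_bochner_integral M (\<lambda>w. cnj ((u w)\<^sup>2) * (g w)\<^sup>2) 0"
  proof -
    have i: "integrable M (\<lambda>w. cnj ((u w)\<^sup>2))"
      using um by (intro integrable_const_bound[where B=1]) (auto simp: norm_power u)
    have "indep_var borel (\<lambda>w. cnj ((u w)\<^sup>2)) borel (\<lambda>w. (g w)\<^sup>2)"
      by (rule indep_var_compose_borel[OF ind]) auto
    from indep_var_has_bochner_integral_mult[OF this has_bochner_integral_integrable[OF i] gm(2)]
    show ?thesis by simp
  qed
  have D: "has_bochner_integral M (\<lambda>w. (u w)\<^sup>2 * cnj ((g w)\<^sup>2)) 0"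
    using has_bochner_integral_cnj[OF C] by simp
  have const: "has_bochner_integral M (\<lambda>_. x) x" for x :: complex
    by (simp add: has_bochner_integral_iff prob_space)
  note intros = has_bochner_integral_add has_bochner_integral_mult_right has_bochner_integral_of_real const
  show ?mean
    using has_bochner_integral_add[OF has_bochner_integral_mult_right[OF u(2)] gm(1)] by simp
  have "has_bochner_integral M (\<lambda>w. complex_of_real (c\<^sup>2) + complex_of_real ((cmod (g w))\<^sup>2)
       + complex_of_real c * (u w * cnj (complex_of_real 1 * g w + complex_of_real 0 * (g w * cnj (g w) * g w))
           + cnj (u w) * (complex_of_real 1 * g w + complex_of_real 0 * (g w * cnj (g w) * g w))))
       (complex_of_real (c\<^sup>2) + complex_of_real v + complex_of_real c * (0 + 0))"
    by (intro intros A B gm)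
  moreover have "(complex_of_real c * u w + g w) * cnj (complex_of_real c * u w + g w)
     = complex_of_real (c\<^sup>2) + complex_of_real ((cmod (g w))\<^sup>2)
       + complex_of_real c * (u w * cnj (complex_of_real 1 * g w + complex_of_real 0 * (g w * cnj (g w) * g w))
           + cnj (u w) * (complex_of_real 1 * g w + complex_of_real 0 * (g w * cnj (g w) * g w)))" for w
    \<comment> \<open>With squared moduli written as products, this is a polynomial identity modulo
      \<open>u w * cnj (u w) = 1\<close>.\<close>
    using uc[of w] unfolding gc[symmetric] by (simp, algebra)
  ultimately show ?second
    by (simp add: ac_simps)
  have "has_bochner_integral M (\<lambda>w. complex_of_real (c ^ 4) + complex_of_real (4 * c\<^sup>2) * complex_of_real ((cmod (g w))\<^sup>2)
       + complex_of_real ((cmod (g w)) ^ 4)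
       + complex_of_real (2 * c) * (u w * cnj (complex_of_real (c\<^sup>2) * g w + complex_of_real 1 * (g w * cnj (g w) * g w))
           + cnj (u w) * (complex_of_real (c\<^sup>2) * g w + complex_of_real 1 * (g w * cnj (g w) * g w)))
       + complex_of_real (c\<^sup>2) * ((u w)\<^sup>2 * cnj ((g w)\<^sup>2) + cnj ((u w)\<^sup>2) * (g w)\<^sup>2))
       (complex_of_real (c ^ 4) + complex_of_real (4 * c\<^sup>2) * complex_of_real v
       + complex_of_real (2 * v\<^sup>2) + complex_of_real (2 * c) * (0 + 0) + complex_of_real (c\<^sup>2) * (0 + 0))"
    by (intro intros A B C D gm)
  moreover have "complex_of_real ((cmod (complex_of_real c * u w + g w)) ^ 4)
     = complex_of_real (c ^ 4) + complex_of_real (4 * c\<^sup>2) * complex_of_real ((cmod (g w))\<^sup>2)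
       + complex_of_real ((cmod (g w)) ^ 4)
       + complex_of_real (2 * c) * (u w * cnj (complex_of_real (c\<^sup>2) * g w + complex_of_real 1 * (g w * cnj (g w) * g w))
           + cnj (u w) * (complex_of_real (c\<^sup>2) * g w + complex_of_real 1 * (g w * cnj (g w) * g w)))
       + complex_of_real (c\<^sup>2) * ((u w)\<^sup>2 * cnj ((g w)\<^sup>2) + cnj ((u w)\<^sup>2) * (g w)\<^sup>2)" for w
  proof -
    have 4: "complex_of_real ((cmod z) ^ 4) = (z * cnj z)\<^sup>2" for z
      by (simp add: complex_norm_square[symmetric] flip: power_mult)
    show ?thesis
      using uc[of w] unfolding 4 gc[symmetric] by (simp, algebra)
  qed
  ultimately have "has_bochner_integral M (\<lambda>w. complex_of_real ((cmod (complex_of_real c * u w + g w)) ^ 4))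
      (complex_of_real (c ^ 4 + 4 * c\<^sup>2 * v + 2 * v\<^sup>2))"
    by simp
  then show ?fourth
    unfolding has_bochner_integral_of_real_iff
    by (simp add: power2_eq_square power4_eq_xxxx algebra_simps)
qed

text \<open>Here \<open>cnj y * h\<close> is s|h|^2 + h cnj(r). In its squared modulus the mixed
  terms are linear in \<open>r\<close> or its conjugate, so independence and the zero mean of
  \<open>r\<close> remove them; s^2|h|^4 and |h|^2|r|^2 remain.\<close>

lemma (in prob_space) pilot_contaminated_moments:
  fixes s :: real
  assumes ind: "indep_var borel h borel r"
    and h: "has_bochner_integral M h 0" "has_bochner_integral M (\<lambda>w. h w * cnj (h w)) (complex_of_real b)"
      "has_bochner_integral M (\<lambda>w. (cmod (h w)) ^ 4) q"
    and r: "has_bochner_integral M r 0" "has_bochner_integral M (\<lambda>w. r w * cnj (r w)) (complex_of_real v)"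
  defines "y \<equiv> \<lambda>w. complex_of_real s * h w + r w"
  shows "has_bochner_integral M (\<lambda>w. cnj (y w) * h w) (complex_of_real (s * b))" (is ?corr)
    and "has_bochner_integral M (\<lambda>w. (cnj (y w) * h w) * cnj (cnj (y w) * h w))
          (complex_of_real (s\<^sup>2 * q + v * b))" (is ?second)
proof -
  have hr: "has_bochner_integral M (\<lambda>w. h w * cnj (r w)) (0 * cnj 0)"
    using has_bochner_integral_cnj[OF r(1)]
    by (intro indep_var_has_bochner_integral_mult h indep_var_compose_borel[OF ind, of "\<lambda>x. x"]) auto
  have "has_bochner_integral M (\<lambda>w. complex_of_real s * (h w * cnj (h w)) + h w * cnj (r w))
     (complex_of_real s * complex_of_real b + 0 * cnj 0)"
    by (intro has_bochner_integral_add has_bochner_integral_mult_right h hr)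
  then show ?corr
    by (simp add: y_def algebra_simps)
  have sq: "has_bochner_integral M (\<lambda>w. (cmod (h w))\<^sup>2) b"
    using h(2) by (simp add: has_bochner_integral_of_real_iff[symmetric] del: of_real_power flip: complex_norm_square)
  have "integrable M (\<lambda>w. h w * cnj (h w) * h w)"
    using h(1,3) sq by (intro integrable_mult_cnj_mult) (auto simp: has_bochner_integral_iff)
  \<comment> \<open>Only the existence of this third-order moment matters: its value
    \<open>t\<close> will be multiplied by the zero mean of \<open>cnj r\<close>.\<close>
  from has_bochner_integral_integrable[OF this] obtain t where t: "has_bochner_integral M (\<lambda>w. h w * cnj (h w) * h w) t"
    by blast
  have h3r: "has_bochner_integral M (\<lambda>w. (h w * cnj (h w) * h w) * cnj (r w)) (t * cnj 0)"
    using has_bochner_integral_cnj[OF r(1)]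
    by (intro indep_var_has_bochner_integral_mult t
        indep_var_compose_borel[OF ind, of "\<lambda>x. x * cnj x * x"]) auto
  have h2r2: "has_bochner_integral M (\<lambda>w. (h w * cnj (h w)) * (r w * cnj (r w))) (complex_of_real b * complex_of_real v)"
    by (intro indep_var_has_bochner_integral_mult h r
        indep_var_compose_borel[OF ind, of "\<lambda>x. x * cnj x" "\<lambda>x. x * cnj x"]) auto
  have "has_bochner_integral M (\<lambda>w. complex_of_real (s\<^sup>2) * complex_of_real ((cmod (h w)) ^ 4)
      + (h w * cnj (h w)) * (r w * cnj (r w))
      + complex_of_real s * ((h w * cnj (h w) * h w) * cnj (r w) + cnj ((h w * cnj (h w) * h w) * cnj (r w))))
     (complex_of_real (s\<^sup>2) * complex_of_real q + complex_of_real b * complex_of_real v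
      + complex_of_real s * (t * cnj 0 + cnj (t * cnj 0)))"
    by (intro has_bochner_integral_add has_bochner_integral_mult_right has_bochner_integral_of_real
        has_bochner_integral_cnj h h2r2 h3r)
  moreover have "(cnj (y w) * h w) * cnj (cnj (y w) * h w) = complex_of_real (s\<^sup>2) * complex_of_real ((cmod (h w)) ^ 4)
      + (h w * cnj (h w)) * (r w * cnj (r w))
      + complex_of_real s * ((h w * cnj (h w) * h w) * cnj (r w) + cnj ((h w * cnj (h w) * h w) * cnj (r w)))" for w
  proof -
    have 4: "complex_of_real ((cmod z) ^ 4) = (z * cnj z)\<^sup>2" for z
      by (simp add: complex_norm_square[symmetric] flip: power_mult)
    show ?thesis
      unfolding 4 y_def by (simp add: power2_eq_square algebra_simps)
  qed
  ultimately show ?second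
    by (simp add: ac_simps)
qed

section \<open>Diagonal and positive definite complex matrices\<close>

lemma diag_mat_matrix_mult: "diag_mat x ** diag_mat y = diag_mat (x * y)"
  by (auto simp: diag_mat_def matrix_matrix_mult_def vec_eq_iff if_distrib[of "\<lambda>z. z * _"]
      if_distrib[of "\<lambda>z. _ * z"] cong: if_cong)

lemma diag_mat_add: "diag_mat x + diag_mat y = diag_mat (x + y)"
  by (auto simp: diag_mat_def vec_eq_iff)

lemma diag_mat_diff: "diag_mat x - diag_mat y = diag_mat (x - y)"
  by (auto simp: diag_mat_def vec_eq_iff)

lemma diag_mat_scaleR: "c *\<^sub>R diag_mat x = diag_mat (c *\<^sub>R x)"
  by (auto simp: diag_mat_def vec_eq_iff)

lemma diag_vec_diag_mat: "diag_vec (diag_mat x) = x"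
  by (auto simp: diag_mat_def diag_vec_def vec_eq_iff)

lemma hermitian_diag_mat: "hermitian (diag_mat x) = diag_mat (\<chi> i. cnj (x $ i))"
  by (auto simp: diag_mat_def hermitian_def vec_eq_iff)

lemma trace_diag_mat: "trace (diag_mat x) = (\<Sum>i\<in>UNIV. x $ i)"
  by (simp add: diag_mat_def trace_def)

lemma diag_mat_mult_vec: "diag_mat a *v x = a * x"
  by (auto simp: diag_mat_def matrix_vector_mult_def vec_eq_iff if_distrib[of "\<lambda>z. z * _"] cong: if_cong)

lemma diag_mat_inv:
  assumes "\<And>i. x $ i \<noteq> 0"
  shows "matrix_inv (diag_mat x) = diag_mat (\<chi> i. inverse (x $ i))"
proof -
  have 1: "diag_mat x ** diag_mat (\<chi> i. inverse (x $ i)) = mat 1"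
    "diag_mat (\<chi> i. inverse (x $ i)) ** diag_mat x = mat 1"
    using assms by (auto simp: diag_mat_matrix_mult) (auto simp: diag_mat_def mat_def vec_eq_iff)
  then have "invertible (diag_mat x)" unfolding invertible_def by blast
  then have "matrix_inv (diag_mat x) ** diag_mat x = mat 1"
    by (metis (mono_tags, lifting) invertible_def matrix_inv_def someI_ex)
  then show ?thesis
    using 1 by (metis matrix_mul_assoc matrix_mul_lid matrix_mul_rid)
qed

section \<open>The sesquilinear form and the Hermitian adjoint\<close>

lemma cdot_add_right: "cdot x (y + z) = cdot x y + cdot x z"
  by (simp add: cdot_def algebra_simps sum.distrib)

lemma cdot_diff_right: "cdot x (y - z) = cdot x y - cdot x z"
  by (simp add: cdot_def algebra_simps sum_subtractf)

lemma cdot_scaleR_right: "cdot x (c *\<^sub>R y) = complex_of_real c * cdot x y"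
  by (simp add: cdot_def sum_distrib_left scaleR_conv_of_real[where 'a=complex] ac_simps)

lemma cdot_sum_right: "cdot x (\<Sum>i\<in>I. f i) = (\<Sum>i\<in>I. cdot x (f i))"
  by (simp add: cdot_def sum_distrib_left) (rule sum.swap)

lemma cnj_cdot: "cnj (cdot x y) = cdot y x"
  by (simp add: cdot_def ac_simps)

lemma matrix_vector_mult_scaleR_left: "(c *\<^sub>R A) *v (x::complex^'n) = c *\<^sub>R (A *v x)"
  by (simp add: matrix_vector_mult_def vec_eq_iff scaleR_sum_right)

lemma matrix_vector_mult_sum_left: "(\<Sum>i\<in>I. A i) *v (x::complex^'n) = (\<Sum>i\<in>I. A i *v x)"
  by (induction I rule: infinite_finite_induct) (auto simp: matrix_vector_mult_add_rdistrib)

lemma cdot_diag_mat: "cdot x (diag_mat d *v y) = (\<Sum>i\<in>UNIV. cnj (x $ i) * d $ i * y $ i)"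
  by (simp add: cdot_def diag_mat_mult_vec ac_simps)

lemma cdot_outer: "cdot x (outer u v *v y) = cdot x u * cdot v y"
proof -
  have "outer u v *v y = cdot v y *s u"
    by (simp add: vec_eq_iff cdot_def outer_def matrix_vector_mult_def sum_distrib_left ac_simps)
  then show ?thesis
    by (simp add: cdot_def[of x] sum_distrib_left ac_simps)
qed

lemma cdot_hermitian: "cdot (hermitian A *v x) y = cdot x (A *v y)"
proof -
  have "cdot (hermitian A *v x) y = (\<Sum>i\<in>UNIV. \<Sum>j\<in>UNIV. A $ j $ i * cnj (x $ j) * y $ i)"
    by (simp add: cdot_def hermitian_def matrix_vector_mult_def sum_distrib_right)
  also have "\<dots> = (\<Sum>j\<in>UNIV. \<Sum>i\<in>UNIV. A $ j $ i * cnj (x $ j) * y $ i)"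
    by (rule sum.swap)
  also have "\<dots> = cdot x (A *v y)"
    by (simp add: cdot_def matrix_vector_mult_def sum_distrib_left ac_simps)
  finally show ?thesis .
qed

lemma
  shows hermitian_add: "hermitian (A + B) = hermitian A + hermitian B"
    and hermitian_diff: "hermitian (A - B) = hermitian A - hermitian B"
    and hermitian_scaleR: "hermitian (c *\<^sub>R A) = c *\<^sub>R hermitian A"
    and hermitian_outer: "hermitian (outer u v) = outer v u"
  by (auto simp: hermitian_def outer_def vec_eq_iff)

lemma hermitian_sum: "hermitian (\<Sum>i\<in>I. A i) = (\<Sum>i\<in>I. hermitian (A i))"
  by (auto simp: hermitian_def vec_eq_iff)

section \<open>Positive definite forms and the Rayleigh quotient\<close>

locale pos_def =
  fixes A :: "complex^'n^'n"
  assumes hermitian: "hermitian A = A"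
    and pos: "x \<noteq> 0 \<Longrightarrow> Re (cdot x (A *v x)) > 0"
begin

lemma cnj_form: "cnj (cdot x (A *v y)) = cdot y (A *v x)"
  by (metis cdot_hermitian cnj_cdot hermitian)

text \<open>By \<open>hermitian\<close> each value equals its own conjugate, so taking
  \<open>Re\<close> in \<open>pos\<close> loses nothing.\<close>

lemma form_real: "cdot x (A *v x) = complex_of_real (Re (cdot x (A *v x)))"
  using cnj_form[of x x] by (simp add: complex_eq_iff)

lemma form_nonneg: "Re (cdot x (A *v x)) \<ge> 0"
  using pos[of x] by (cases "x = 0") (auto simp: cdot_def)

text \<open>A kernel vector gives the form the value zero, so positivity makes the kernel
  trivial.\<close>

lemma invertible: "invertible A"
proof -
  have "x = 0" if "A *v x = 0" for x
    using pos[of x] that by (cases "x = 0") (auto simp: cdot_def)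
  then show ?thesis
    using matrix_left_invertible_ker[of A] invertible_left_inverse[of A] by blast
qed

lemma mult_matrix_inv: "A *v (matrix_inv A *v x) = x"
proof -
  have "A ** matrix_inv A = mat 1"
    by (metis (mono_tags, lifting) invertible invertible_def matrix_inv_def someI_ex)
  then show ?thesis by (simp add: matrix_vector_mul_assoc)
qed

lemma Cauchy_Schwarz:
  "(cmod (cdot x (A *v y)))\<^sup>2 \<le> Re (cdot x (A *v x)) * Re (cdot y (A *v y))"
proof (cases "y = 0")
  case True
  then show ?thesis by (simp add: cdot_def)
next
  case False
  define q where "q = Re (cdot y (A *v y))"
  define z where "z = cdot y (A *v x)"
  have q: "q > 0" using pos[OF False] by (simp add: q_def)
  have yy: "cdot y (A *v y) = complex_of_real q" using form_real q_def by simp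
  have xy: "cdot x (A *v y) = cnj z" using cnj_form z_def by simp
  \<comment> \<open>The component of \<open>x\<close> orthogonal to \<open>y\<close> in the inner
    product given by \<open>A\<close>. Nonnegativity of the form at \<open>u\<close> is the claimed
    inequality divided by \<open>q\<close>.\<close>
  define u where "u = x - (z / complex_of_real q) *s y"
  have r: "cdot a (A *v (b - c *s d)) = cdot a (A *v b) - c * cdot a (A *v d)" for a b d and c :: complex
    by (simp add: cdot_def vec.diff vec.scale algebra_simps sum_subtractf sum_distrib_left)
  have l: "cdot (b - c *s d) a = cdot b a - cnj c * cdot d a" for a b d :: "complex^'n" and c
    by (simp add: cdot_def algebra_simps sum_subtractf sum_distrib_left)
  have "cdot u (A *v u) = cdot x (A *v x) - z * cnj z / complex_of_real q"
    unfolding u_def r l yy xy z_def[symmetric] using q by (simp add: field_simps)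
  then have "0 \<le> Re (cdot x (A *v x)) - (cmod z)\<^sup>2 / q"
    using form_nonneg[of u] by (simp add: complex_norm_square[symmetric] Re_divide_of_real)
  then show ?thesis
    using q by (simp add: xy q_def[symmetric] field_simps)
qed

text \<open>Apply \<open>Cauchy_Schwarz\<close> to \<open>x\<close> and
  \<open>matrix_inv A *v b\<close>: the mixed form becomes \<open>cdot x b\<close>, and the form at
  the second vector becomes the right-hand side.\<close>

lemma Rayleigh_le:
  assumes "x \<noteq> 0"
  shows "(cmod (cdot x b))\<^sup>2 / Re (cdot x (A *v x)) \<le> Re (cdot b (matrix_inv A *v b))"
proof -
  have "Re (cdot (matrix_inv A *v b) b) = Re (cdot b (matrix_inv A *v b))"
    by (metis cnj_cdot cnj.simps(1))
  then show ?thesis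
    using Cauchy_Schwarz[of x "matrix_inv A *v b"] pos[OF assms]
    by (simp add: mult_matrix_inv field_simps)
qed

text \<open>Up to conjugation this is the value of the form of \<open>A\<close> at
  \<open>matrix_inv A *v b\<close>, which is real.\<close>

lemma form_inv_real: "cdot b (matrix_inv A *v b) \<in> \<real>"
proof -
  have "cdot (matrix_inv A *v b) b \<in> \<real>"
    using form_real[of "matrix_inv A *v b"] by (metis Reals_of_real mult_matrix_inv)
  then show ?thesis
    by (metis Reals_cnj_iff cnj_cdot)
qed

lemma matrix_inv_neq_0: "b \<noteq> 0 \<Longrightarrow> matrix_inv A *v b \<noteq> 0"
  using mult_matrix_inv[of b] by force

end

section \<open>Moments of the pilot observations\<close>

text \<open>
  For a fixed access point the observables are indexed by \<open>'k + 't\<close>: the channels of the users and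
  the pilot noise coordinates. They are expressed as functions of the configuration of all sources,
  each depending on its own block of sources only.
\<close>

definition obs ::
    "('m, 'k, 't::finite, 'w) uplink \<Rightarrow> 'm \<Rightarrow> 'k + 't \<Rightarrow> (('m, 'k, 't) source \<Rightarrow> complex) \<Rightarrow> complex" where
  "obs S m j x = (case j of
       Inl l \<Rightarrow> complex_of_real (hbar S m l) * exp (\<i> * x (Phase m l)) + x (Scatter m l)
     | Inr i \<Rightarrow> x (Noise m i))"

definition block :: "'m \<Rightarrow> 'k + 't \<Rightarrow> ('m, 'k, 't) source set" where
  "block m j = (case j of Inl l \<Rightarrow> {Phase m l, Scatter m l} | Inr i \<Rightarrow> {Noise m i})"

text \<open>The variances of the observables, all of which have mean zero.\<close>

definition obs_var :: "('m, 'k, 't::finite, 'w) uplink \<Rightarrow> 'm \<Rightarrow> 'k + 't \<Rightarrow> real" where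
  "obs_var S m j = (case j of Inl l \<Rightarrow> beta' S m l | Inr i \<Rightarrow> sigma2 S)"

text \<open>Coefficients of the pilot observation as a linear combination of all observables. Zeros
  for users with another pilot let the sum run over the whole index type.\<close>

definition pilot_coeff ::
    "('m::finite, 'k::finite, 't::finite, 'w) uplink \<Rightarrow> 'k \<Rightarrow> 'k + 't \<Rightarrow> complex" where
  "pilot_coeff S k j = (case j of
       Inl l \<Rightarrow> (if l \<in> copilot S k then complex_of_real (sqrt (pilot_power S l) * tau_p S) else 0)
     | Inr i \<Rightarrow> cnj (pilot_seq S (pilot_of S k) $ i))"

text \<open>The user part of \<open>pilot_coeff\<close> as a real number, the form in which
  \<open>pilot_contaminated_moments\<close> takes its factor \<open>s\<close>.\<close>

definition pilot_gain :: "('m::finite, 'k::finite, 't::finite, 'w) uplink \<Rightarrow> 'k \<Rightarrow> 'k \<Rightarrow> real" where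
  "pilot_gain S k l = (if l \<in> copilot S k then sqrt (pilot_power S l) * tau_p S else 0)"

lemma obs_measurable: "block m j \<subseteq> A \<Longrightarrow> obs S m j \<in> borel_measurable (PiM A (\<lambda>_. borel))"
  by (auto simp: obs_def [abs_def] block_def split: sum.splits
      intro!: borel_measurable_add borel_measurable_times measurable_compose[OF _ borel_measurable_exp]
        measurable_component_singleton)

lemma obs_local: "block m j \<subseteq> A \<Longrightarrow> obs S m j (restrict x A) = obs S m j x"
  by (auto simp: obs_def block_def split: sum.splits)

lemma block_disjoint: "(m, i) \<noteq> (n, j) \<Longrightarrow> block m i \<inter> block n j = {}"
  by (auto simp: block_def split: sum.splits)

lemma tau_p_pos: "tau_p (S :: ('m, 'k, 't::finite, 'w) uplink) > 0"
  by (simp add: tau_p_def)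

lemma sum_Plus_UNIV:
  fixes f :: "'a::finite + 'b::finite \<Rightarrow> 'c::comm_monoid_add"
  shows "(\<Sum>j\<in>UNIV. f j) = (\<Sum>l\<in>UNIV. f (Inl l)) + (\<Sum>i\<in>UNIV. f (Inr i))"
  unfolding UNIV_Plus_UNIV[symmetric] by (subst sum.Plus) (auto simp: o_def)

lemma channel_obs: "channel S l w $ m = obs S m (Inl l) (\<lambda>s. source_var S s w)"
  by (simp add: channel_def obs_def source_var_def)

lemma pilot_obs_obs:
  "pilot_obs S m k w = (\<Sum>j\<in>UNIV. pilot_coeff S k j * obs S m j (\<lambda>s. source_var S s w))"
proof -
  have "(\<Sum>l\<in>copilot S k. complex_of_real (sqrt (pilot_power S l) * tau_p S) * channel S l w $ m)
     = (\<Sum>l\<in>UNIV. pilot_coeff S k (Inl l) * obs S m (Inl l) (\<lambda>s. source_var S s w))"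
    unfolding channel_obs by (intro sum.mono_neutral_cong_left) (auto simp: pilot_coeff_def)
  then show ?thesis
    by (simp add: pilot_obs_def sum_Plus_UNIV cdot_def) (simp add: pilot_coeff_def obs_def source_var_def)
qed

context uplink_model
begin

abbreviation "src w \<equiv> (\<lambda>s. source_var S s w)"

lemma beta'_pos: "beta' S m l > 0"
  using beta_pos by (simp add: beta'_def add_pos_nonneg)

lemma lambda'_pos: "lambda' S m k > 0"
  unfolding lambda'_def
  using sigma2_pos pilot_power_pos beta'_pos[of m] tau_p_pos[of S]
  by (intro add_nonneg_pos sum_nonneg) (auto intro!: mult_nonneg_nonneg less_imp_le)

lemma copilot_refl: "k \<in> copilot S k"
  by (simp add: copilot_def)

lemma phase_scatter_indep:
  "indep_var borel (\<lambda>w. exp (\<i> * complex_of_real (phase S m l w))) borel (scatter S m l)"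
proof -
  have "indep_var borel (\<lambda>w. exp (\<i> * src w (Phase m l))) borel (\<lambda>w. src w (Scatter m l))"
    by (rule indep_var_blocks[OF sources_indep, of "{Phase m l}" "{Scatter m l}" "\<lambda>x. exp (\<i> * x (Phase m l))" "\<lambda>x. x (Scatter m l)"])
       (auto intro!: borel_measurable_times measurable_compose[OF _ borel_measurable_exp] measurable_component_singleton)
  then show ?thesis
    by (simp add: source_var_def)
qed

section \<open>Moments of channels and noise at one access point\<close>

lemma
  shows channel_mean: "has_bochner_integral (outcomes S) (\<lambda>w. obs S m (Inl l) (src w)) 0"
    and channel_second_moment: "has_bochner_integral (outcomes S)
       (\<lambda>w. obs S m (Inl l) (src w) * cnj (obs S m (Inl l) (src w))) (complex_of_real (beta' S m l))"
    and channel_fourth_moment: "has_bochner_integral (outcomes S)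
       (\<lambda>w. (cmod (obs S m (Inl l) (src w))) ^ 4)
       ((beta' S m l)\<^sup>2 + (beta S m l)\<^sup>2 + 2 * (hbar S m l)\<^sup>2 * beta S m l)"
  using rician_moments[OF phase_scatter_indep _ uniform_phase_mean[OF phase_uniform] scatter_normal beta_pos,
      of m l "hbar S m l"]
  by (simp_all add: obs_def source_var_def beta'_def norm_exp_i_times)

lemma obs_mean: "has_bochner_integral (outcomes S) (\<lambda>w. obs S m j (src w)) 0"
proof (cases j)
  case (Inl l)
  then show ?thesis using channel_mean by simp
next
  case (Inr i)
  then show ?thesis
    using complex_normal_moments(1)[OF noise_normal sigma2_pos] by (simp add: obs_def source_var_def)
qed

lemma obs_second_moment:
  "has_bochner_integral (outcomes S) (\<lambda>w. obs S m j (src w) * cnj (obs S m j (src w)))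
     (complex_of_real (obs_var S m j))"
proof (cases j)
  case (Inl l)
  then show ?thesis using channel_second_moment by (simp add: obs_var_def)
next
  case (Inr i)
  have "has_bochner_integral (outcomes S) (\<lambda>w. complex_of_real ((cmod (pilot_noise S m w $ i))\<^sup>2))
    (complex_of_real (sigma2 S))"
    by (intro has_bochner_integral_of_real complex_normal_moments noise_normal sigma2_pos)
  then show ?thesis
    unfolding complex_norm_square by (simp add: Inr obs_def source_var_def obs_var_def)
qed

lemma obs_uncorrelated:
  assumes "i \<noteq> j"
  shows "has_bochner_integral (outcomes S) (\<lambda>w. obs S m i (src w) * cnj (obs S m j (src w))) 0"
proof -
  have "indep_var borel (\<lambda>w. obs S m i (src w)) borel (\<lambda>w. obs S m j (src w))"
    using assms
    by (intro indep_var_blocks[OF sources_indep, of "block m i" "block m j" "obs S m i" "obs S m j"] obs_measurable obs_local block_disjoint) auto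
  then have "indep_var borel (\<lambda>w. obs S m i (src w)) borel (\<lambda>w. cnj (obs S m j (src w)))"
    by (rule indep_var_compose_borel[of _ _ "\<lambda>x. x"]) auto
  from indep_var_has_bochner_integral_mult[OF this obs_mean has_bochner_integral_cnj[OF obs_mean]]
  show ?thesis by simp
qed

lemma obs_sum_second_moment:
  fixes J :: "('k + 't) set"
  shows "has_bochner_integral (outcomes S)
     (\<lambda>w. (\<Sum>j\<in>J. c j * obs S m j (src w)) * cnj (\<Sum>j\<in>J. c j * obs S m j (src w)))
     (complex_of_real (\<Sum>j\<in>J. (cmod (c j))\<^sup>2 * obs_var S m j))"
proof -
  have "has_bochner_integral (outcomes S)
     (\<lambda>w. (\<Sum>j\<in>J. c j * obs S m j (src w)) * cnj (\<Sum>j\<in>J. c j * obs S m j (src w)))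
     (\<Sum>i\<in>J. \<Sum>j\<in>J. c i * cnj (c j) * (if i = j then complex_of_real (obs_var S m i) else 0))"
    using obs_second_moment obs_uncorrelated by (intro has_bochner_integral_sum_mult_cnj) auto
  then show ?thesis
    by (simp add: if_distrib[of "\<lambda>z. _ * z"] complex_norm_square del: of_real_power cong: if_cong)
qed

text \<open>This sum is the mean power of the pilot observation. A pilot-sharing user contributes
  its pilot power times tau_p^2 times \<open>beta'\<close>, and the noise contributes the squared
  pilot norm tau_p times \<open>sigma2\<close>; one common factor tau_p leaves
  \<open>lambda'\<close>.\<close>

lemma sum_pilot_coeff_obs_var:
  "(\<Sum>j\<in>UNIV. (cmod (pilot_coeff S k j))\<^sup>2 * obs_var S m j) = tau_p S * lambda' S m k"
proof -
  have "(\<Sum>l\<in>UNIV. (cmod (pilot_coeff S k (Inl l)))\<^sup>2 * obs_var S m (Inl l))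
      = (\<Sum>l\<in>copilot S k. pilot_power S l * (tau_p S)\<^sup>2 * beta' S m l)"
    using pilot_power_pos
    by (intro sum.mono_neutral_cong_right)
       (auto simp: pilot_coeff_def obs_var_def norm_mult power_mult_distrib less_imp_le)
  moreover have "(\<Sum>i\<in>UNIV. (cmod (pilot_coeff S k (Inr i)))\<^sup>2 * obs_var S m (Inr i)) = tau_p S * sigma2 S"
    using pilots_norm[of "pilot_of S k"]
    by (simp add: pilot_coeff_def obs_var_def norm_vec_def L2_set_def sum_nonneg flip: sum_distrib_right)
  ultimately show ?thesis
    by (simp add: sum_Plus_UNIV lambda'_def algebra_simps sum_distrib_left power2_eq_square)
qed

lemma pilot_obs_second_moment:
  "has_bochner_integral (outcomes S) (\<lambda>w. (cmod (pilot_obs S m k w))\<^sup>2) (tau_p S * lambda' S m k)"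
  using obs_sum_second_moment[where J = UNIV and c = "pilot_coeff S k" and m = m]
  unfolding sum_pilot_coeff_obs_var pilot_obs_obs[symmetric] complex_norm_square[symmetric]
  by (simp only: has_bochner_integral_of_real_iff)

section \<open>Products of a pilot observation with a channel, and their independence over access
  points\<close>

lemma
  shows pilot_obs_channel_corr:
    "has_bochner_integral (outcomes S) (\<lambda>w. cnj (pilot_obs S m k w) * channel S l w $ m)
       (complex_of_real (pilot_gain S k l * beta' S m l))"
    and pilot_obs_channel_second_moment:
    "has_bochner_integral (outcomes S)
       (\<lambda>w. (cnj (pilot_obs S m k w) * channel S l w $ m) * cnj (cnj (pilot_obs S m k w) * channel S l w $ m))
       (complex_of_real (tau_p S * lambda' S m k * beta' S m l
          + (pilot_gain S k l)\<^sup>2 * ((beta S m l)\<^sup>2 + 2 * (hbar S m l)\<^sup>2 * beta S m l)))"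
proof -
  \<comment> \<open>Removing the channel of user \<open>l\<close> leaves a remainder
    \<open>r\<close> built from other source blocks, hence independent of that channel. For a user
    with another pilot the gain is zero and \<open>r\<close> is the whole observation.\<close>
  define J where "J = (UNIV :: ('k + 't) set) - {Inl l}"
  define r where "r x = (\<Sum>j\<in>J. pilot_coeff S k j * obs S m j x)" for x
  \<comment> \<open>The second moment of \<open>r\<close>: the total power of the observation minus
    the share of user \<open>l\<close>.\<close>
  define v where "v = tau_p S * lambda' S m k - (pilot_gain S k l)\<^sup>2 * beta' S m l"
  have c: "pilot_coeff S k (Inl l) = complex_of_real (pilot_gain S k l)"
    by (simp add: pilot_coeff_def pilot_gain_def)
  have y: "pilot_obs S m k w = complex_of_real (pilot_gain S k l) * obs S m (Inl l) (src w) + r (src w)" for w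
    unfolding pilot_obs_obs r_def J_def by (subst sum.remove[of _ "Inl l"]) (auto simp: c)
  have "(\<Sum>j\<in>J. (cmod (pilot_coeff S k j))\<^sup>2 * obs_var S m j) = v"
    using sum_pilot_coeff_obs_var[of k m]
    by (subst (asm) sum.remove[of _ "Inl l"]) (auto simp: c v_def J_def obs_var_def)
  then have r2: "has_bochner_integral (outcomes S) (\<lambda>w. r (src w) * cnj (r (src w))) (complex_of_real v)"
    using obs_sum_second_moment[where J = J and c = "pilot_coeff S k" and m = m] by (simp only: r_def)
  have "has_bochner_integral (outcomes S) (\<lambda>w. r (src w)) (\<Sum>j\<in>J. pilot_coeff S k j * 0)"
    unfolding r_def by (intro has_bochner_integral_sum has_bochner_integral_mult_right obs_mean)
  then have r1: "has_bochner_integral (outcomes S) (\<lambda>w. r (src w)) 0"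
    by simp
  have ind: "indep_var borel (\<lambda>w. obs S m (Inl l) (src w)) borel (\<lambda>w. r (src w))"
  proof (rule indep_var_blocks[OF sources_indep, of "block m (Inl l)" "\<Union>j\<in>J. block m j" "obs S m (Inl l)" r])
    show "block m (Inl l) \<inter> (\<Union>j\<in>J. block m j) = {}"
      by (auto simp: J_def block_def split: sum.splits)
    have sub: "block m j \<subseteq> (\<Union>j\<in>J. block m j)" if "j \<in> J" for j using that by blast
    show "r \<in> borel_measurable (Pi\<^sub>M (\<Union>j\<in>J. block m j) (\<lambda>_. borel))"
      unfolding r_def [abs_def]
      by (intro borel_measurable_sum borel_measurable_times borel_measurable_const obs_measurable sub)
    show "r (restrict x (\<Union>j\<in>J. block m j)) = r x" for x
      unfolding r_def by (intro sum.cong refl arg_cong2[where f = "(*)"] obs_local sub)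
  qed (auto intro: obs_measurable obs_local)
  note M = pilot_contaminated_moments[OF ind channel_mean channel_second_moment channel_fourth_moment r1 r2,
      of "pilot_gain S k l"]
  show "has_bochner_integral (outcomes S) (\<lambda>w. cnj (pilot_obs S m k w) * channel S l w $ m)
       (complex_of_real (pilot_gain S k l * beta' S m l))"
    using M(1) by (simp only: y channel_obs)
  \<comment> \<open>The squared \<open>beta'\<close> in the fourth moment cancels against the share
    subtracted in \<open>v\<close>.\<close>
  have v_eq: "(pilot_gain S k l)\<^sup>2 * ((beta' S m l)\<^sup>2 + (beta S m l)\<^sup>2 + 2 * (hbar S m l)\<^sup>2 * beta S m l) + v * beta' S m l
     = tau_p S * lambda' S m k * beta' S m l
          + (pilot_gain S k l)\<^sup>2 * ((beta S m l)\<^sup>2 + 2 * (hbar S m l)\<^sup>2 * beta S m l)"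
    by (simp add: v_def algebra_simps power2_eq_square)
  show "has_bochner_integral (outcomes S)
       (\<lambda>w. (cnj (pilot_obs S m k w) * channel S l w $ m) * cnj (cnj (pilot_obs S m k w) * channel S l w $ m))
       (complex_of_real (tau_p S * lambda' S m k * beta' S m l
          + (pilot_gain S k l)\<^sup>2 * ((beta S m l)\<^sup>2 + 2 * (hbar S m l)\<^sup>2 * beta S m l)))"
    using M(2) unfolding v_eq by (simp only: y channel_obs)
qed

text \<open>Each product reads only sources carrying the index of its own access point, and these
  sets of sources are disjoint.\<close>

lemma ap_indep:
  assumes "m \<noteq> n"
  shows "indep_var borel (\<lambda>w. cnj (pilot_obs S m k w) * channel S l w $ m)
     borel (\<lambda>w. cnj (pilot_obs S n k w) * channel S l w $ n)"
proof -
  define V where "V m x = cnj (\<Sum>j\<in>UNIV. pilot_coeff S k j * obs S m j x) * obs S m (Inl l) x" for m x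
  define B where "B m = (\<Union>j\<in>(UNIV :: ('k + 't) set). block m j)" for m :: 'm
  have sub: "block m j \<subseteq> B m" for m j by (auto simp: B_def)
  have meas: "V m \<in> borel_measurable (PiM (B m) (\<lambda>_. borel))" for m
    unfolding V_def [abs_def]
    by (intro borel_measurable_sum borel_measurable_times borel_measurable_const obs_measurable sub
        measurable_compose[OF _ borel_measurable_cnj])
  have loc: "V m (restrict x (B m)) = V m x" for m x
    by (simp only: V_def obs_local[OF sub])
  have "B m \<inter> B n = {}"
    unfolding B_def using block_disjoint[of m _ n] assms by auto
  then have "indep_var borel (\<lambda>w. V m (src w)) borel (\<lambda>w. V n (src w))"
    by (rule indep_var_blocks[OF sources_indep, of "B m" "B n" "V m" "V n"]) (fact meas loc)+
  then show ?thesis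
    by (simp only: V_def pilot_obs_obs channel_obs)
qed

end

section \<open>Closed form of the SINR\<close>

definition omega' :: "('m, 'k::finite, 't::finite, 'w) uplink \<Rightarrow> 'm \<Rightarrow> 'k \<Rightarrow> real" where
  "omega' S m k = (beta' S m k)\<^sup>2 / lambda' S m k"

definition cross_gain :: "('m, 'k::finite, 't::finite, 'w) uplink \<Rightarrow> 'k \<Rightarrow> 'k \<Rightarrow> 'm \<Rightarrow> real" where
  "cross_gain S k l m = beta' S m l * beta' S m k / lambda' S m k"

text \<open>Up to the power and pilot factors, the part of the per-access-point variance that pilot
  sharing adds to the contribution of \<open>T1\<close>. The subtracted square is the squared
  mean.\<close>

definition rician_excess :: "('m, 'k::finite, 't::finite, 'w) uplink \<Rightarrow> 'k \<Rightarrow> 'k \<Rightarrow> 'm \<Rightarrow> real" where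
  "rician_excess S k l m =
     (beta' S m k / lambda' S m k)\<^sup>2 * ((beta S m l)\<^sup>2 + 2 * (hbar S m l)\<^sup>2 * beta S m l)
     - (cross_gain S k l m)\<^sup>2"

definition diag_form :: "complex^'m::finite \<Rightarrow> ('m \<Rightarrow> real) \<Rightarrow> real" where
  "diag_form a f = (\<Sum>m\<in>UNIV. (cmod (a $ m))\<^sup>2 * f m)"

text \<open>As \<open>f\<close> is real, this is the quadratic form at \<open>a\<close> of the
  rank-one matrix \<open>outer f f\<close>.\<close>

definition lin_form :: "complex^'m::finite \<Rightarrow> ('m \<Rightarrow> real) \<Rightarrow> real" where
  "lin_form a f = (cmod (\<Sum>m\<in>UNIV. a $ m * complex_of_real (f m)))\<^sup>2"

text \<open>This and the next three are real counterparts of the complex closed forms. Both the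
  traces and the quadratic forms are reduced to them, which also shows that those are real.\<close>

definition T1_form :: "('m::finite, 'k::finite, 't::finite, 'w) uplink \<Rightarrow> 'k \<Rightarrow> 'k \<Rightarrow> complex^'m \<Rightarrow> real" where
  "T1_form S k l a = pilot_power S k * tau_p S * diag_form a (\<lambda>m. beta' S m l * omega' S m k)"

definition T2_form :: "('m::finite, 'k::finite, 't::finite, 'w) uplink \<Rightarrow> 'k \<Rightarrow> 'k \<Rightarrow> complex^'m \<Rightarrow> real" where
  "T2_form S k l a = pilot_power S k * pilot_power S l * (tau_p S)\<^sup>2
     * (diag_form a (rician_excess S k l) + lin_form a (cross_gain S k l))"

text \<open>The factor \<open>data_power S k\<close> is left out, so that this is the squared
  modulus of the mean itself and can be compared with a second moment.\<close>

definition num_form :: "('m::finite, 'k::finite, 't::finite, 'w) uplink \<Rightarrow> 'k \<Rightarrow> complex^'m \<Rightarrow> real" where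
  "num_form S k a = (pilot_power S k)\<^sup>2 * (tau_p S)\<^sup>2 * lin_form a (\<lambda>m. omega' S m k)"

definition den_form :: "('m::finite, 'k::finite, 't::finite, 'w) uplink \<Rightarrow> 'k \<Rightarrow> complex^'m \<Rightarrow> real" where
  "den_form S k a =
     (\<Sum>l\<in>UNIV. data_power S l * T1_form S k l a) + (\<Sum>l\<in>copilot S k. data_power S l * T2_form S k l a)
     - data_power S k * num_form S k a
     + sigma2 S * pilot_power S k * tau_p S * diag_form a (\<lambda>m. omega' S m k)"

text \<open>The combined signal carries conjugated LSFD coefficients, the trace formulas
  unconjugated ones. For real \<open>f\<close> the two sums are conjugate to each other and have the
  same modulus.\<close>

lemma lin_form_cnj:
  "(cmod (\<Sum>m\<in>UNIV. cnj (a $ m) * complex_of_real (f m)))\<^sup>2 = lin_form a f"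
proof -
  have "(\<Sum>m\<in>UNIV. cnj (a $ m) * complex_of_real (f m)) = cnj (\<Sum>m\<in>UNIV. a $ m * complex_of_real (f m))"
    by simp
  then show ?thesis
    by (simp only: lin_form_def complex_mod_cnj)
qed

lemma lin_form_scale: "lin_form a (\<lambda>m. c * f m) = c\<^sup>2 * lin_form a f"
proof -
  have "(\<Sum>m\<in>UNIV. a $ m * complex_of_real (c * f m))
      = complex_of_real c * (\<Sum>m\<in>UNIV. a $ m * complex_of_real (f m))"
    by (simp add: sum_distrib_left ac_simps)
  then show ?thesis
    by (simp only: lin_form_def norm_mult norm_of_real power_mult_distrib power2_abs)
qed

lemma cdot_diag_form:
  "cdot a (diag_mat (\<chi> m. complex_of_real (f m)) *v a) = complex_of_real (diag_form a f)"
  by (simp add: cdot_diag_mat diag_form_def complex_norm_square ac_simps del: of_real_power)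

lemma trace_diag_form:
  "trace (hermitian (diag_mat a) ** diag_mat (\<chi> m. complex_of_real (f m)) ** diag_mat a)
     = complex_of_real (diag_form a f)"
  by (simp add: hermitian_diag_mat diag_mat_matrix_mult trace_diag_mat diag_form_def
      complex_norm_square ac_simps del: of_real_power)

lemma cdot_outer_lin_form:
  "cdot a (outer (\<chi> m. complex_of_real (f m)) (\<chi> m. complex_of_real (f m)) *v a)
     = complex_of_real (lin_form a f)"
  unfolding cdot_outer lin_form_def complex_norm_square by (simp add: cdot_def ac_simps)

lemma diag_mat_real_mult:
  "diag_mat (\<chi> m. complex_of_real (f m)) ** diag_mat (\<chi> m. complex_of_real (g m))
     = diag_mat (\<chi> m. complex_of_real (f m * g m))"
  by (simp add: diag_mat_matrix_mult) (simp add: diag_mat_def vec_eq_iff)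

section \<open>Reduction of matrices, traces and quadratic forms to diagonal entries\<close>

context uplink_model
begin

lemma matR'_diag: "matR' S k = diag_mat (\<chi> m. complex_of_real (beta' S m k))"
  by (simp add: matR'_def matR_def matL_def diag_mat_add) (simp add: diag_mat_def vec_eq_iff beta'_def)

lemma Lambda'_diag: "Lambda' S k = diag_mat (\<chi> m. complex_of_real (inverse (lambda' S m k)))"
  unfolding Lambda'_def using lambda'_pos[THEN less_imp_neq, THEN not_sym]
  by (subst diag_mat_inv) auto

lemma Omega'_diag: "Omega' S k = diag_mat (\<chi> m. complex_of_real (omega' S m k))"
  by (simp add: Omega'_def matR'_diag Lambda'_diag diag_mat_real_mult omega'_def
      divide_inverse power2_eq_square ac_simps del: of_real_mult of_real_inverse)

lemma cross_diag: "matR' S l ** Lambda' S k ** matR' S k = diag_mat (\<chi> m. complex_of_real (cross_gain S k l m))"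
  by (simp add: matR'_diag Lambda'_diag diag_mat_real_mult cross_gain_def
      divide_inverse ac_simps del: of_real_mult of_real_inverse)

lemma Gamma1_diag:
  "Gamma1 S k l = (pilot_power S k * tau_p S) *\<^sub>R diag_mat (\<chi> m. complex_of_real (beta' S m l * omega' S m k))"
  by (simp only: Gamma1_def matR'_diag Omega'_diag diag_mat_real_mult)

text \<open>The entries of \<open>Lambda' S k ** Omega' S k\<close> are the squares of
  \<open>beta' S m k / lambda' S m k\<close>, the common factor in
  \<open>rician_excess\<close>.\<close>

lemma excess_diag:
  "matR S l ** matR S l ** Lambda' S k ** Omega' S k
     + 2 *\<^sub>R (Lambda' S k ** Omega' S k ** matL S l ** matR S l)
     - (matR' S l ** Lambda' S k ** matR' S k) ** (matR' S l ** Lambda' S k ** matR' S k)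
   = diag_mat (\<chi> m. complex_of_real (rician_excess S k l m))"
proof -
  have "rician_excess S k l m =
      (beta S m l * beta S m l * inverse (lambda' S m k) * omega' S m k
     + 2 * (inverse (lambda' S m k) * omega' S m k * (hbar S m l)\<^sup>2 * beta S m l))
     - cross_gain S k l m * cross_gain S k l m" for m
    by (simp add: rician_excess_def omega'_def divide_inverse power2_eq_square algebra_simps)
  then show ?thesis
    unfolding cross_diag
    by (simp add: matR_def matL_def Lambda'_diag Omega'_diag diag_mat_real_mult
        diag_mat_scaleR diag_mat_add diag_mat_diff del: of_real_mult of_real_inverse of_real_power)
       (simp add: diag_mat_def vec_eq_iff scaleR_conv_of_real)
qed

lemma Gamma2_diag:
  "Gamma2 S k l = (pilot_power S k * pilot_power S l * (tau_p S)\<^sup>2) *\<^sub>R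
     (diag_mat (\<chi> m. complex_of_real (rician_excess S k l m))
      + outer (\<chi> m. complex_of_real (cross_gain S k l m)) (\<chi> m. complex_of_real (cross_gain S k l m)))"
proof -
  have "diag_vec (matR' S l ** Lambda' S k ** matR' S k) = (\<chi> m. complex_of_real (cross_gain S k l m))"
    by (simp add: cross_diag diag_vec_diag_mat)
  then show ?thesis
    unfolding Gamma2_def Let_def excess_diag[symmetric] by (simp add: algebra_simps)
qed

lemma b_lmmse_eq: "b_lmmse S k = (\<chi> m. complex_of_real (pilot_power S k * tau_p S * omega' S m k))"
  by (simp add: b_lmmse_def Omega'_diag diag_vec_diag_mat vec_eq_iff scaleR_conv_of_real[where 'a = complex])

lemma T1_eq: "T1 S k l a = complex_of_real (T1_form S k l a)"
  using trace_diag_form[of a "\<lambda>m. beta' S m l * omega' S m k"]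
  by (simp add: T1_def T1_form_def matR'_diag Omega'_diag Let_def diag_mat_real_mult
      matrix_mul_assoc[symmetric] del: of_real_mult) simp

lemma T2_eq: "T2 S k l a = complex_of_real (T2_form S k l a)"
proof -
  let ?A = "diag_mat a" and ?D = "matR' S l ** Lambda' S k ** matR' S k"
  have lin: "(cmod (trace (?A ** ?D)))\<^sup>2 = lin_form a (cross_gain S k l)"
    by (simp add: cross_diag diag_mat_matrix_mult trace_diag_mat lin_form_def)
  \<comment> \<open>Linearity gathers the three separate traces of \<open>T2\<close> into the trace
    of the single matrix in \<open>excess_diag\<close>.\<close>
  have tr_add: "trace (hermitian ?A ** (X + 2 *\<^sub>R Y - Z) ** ?A)
     = trace (hermitian ?A ** X ** ?A) + 2 * trace (hermitian ?A ** Y ** ?A) - trace (hermitian ?A ** Z ** ?A)"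
    for X Y Z :: "complex^'m^'m"
    by (simp add: hermitian_diag_mat trace_def matrix_matrix_mult_def diag_mat_def scaleR_conv_of_real
        if_distrib[of "\<lambda>z. z * _"] if_distrib[of "\<lambda>z. _ * z"] sum.distrib sum_subtractf
        sum_distrib_left algebra_simps cong: if_cong)
  let ?X = "trace (hermitian ?A ** (matR S l ** matR S l) ** Lambda' S k ** Omega' S k ** ?A)"
    and ?Y = "trace (hermitian ?A ** Lambda' S k ** Omega' S k ** matL S l ** matR S l ** ?A)"
    and ?Z = "trace (hermitian ?A ** (?D ** ?D) ** ?A)"
  have "?X + 2 * ?Y - ?Z = complex_of_real (diag_form a (rician_excess S k l))"
    unfolding trace_diag_form[symmetric] excess_diag[symmetric] tr_add
    by (simp add: matrix_mul_assoc)
  then have "?X + complex_of_real ((cmod (trace (?A ** ?D)))\<^sup>2) + 2 * ?Y - ?Z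
      = complex_of_real (diag_form a (rician_excess S k l) + lin_form a (cross_gain S k l))"
    by (simp only: lin of_real_add) (simp add: algebra_simps)
  then show ?thesis
    by (simp only: T2_def T2_form_def Let_def of_real_mult)
qed

lemma gamma_num_eq: "gamma_num S k a = complex_of_real (data_power S k * num_form S k a)"
  by (simp add: gamma_num_def num_form_def Omega'_diag diag_mat_matrix_mult trace_diag_mat lin_form_def)

lemma gamma_den_eq: "gamma_den S k a = complex_of_real (den_form S k a)"
  by (simp add: gamma_den_def den_form_def T1_eq T2_eq gamma_num_eq Omega'_diag trace_diag_form)

lemma cdot_outer_b_lmmse: "cdot a (outer (b_lmmse S k) (b_lmmse S k) *v a) = complex_of_real (num_form S k a)"
proof -
  have "lin_form a (\<lambda>m. pilot_power S k * tau_p S * omega' S m k) = num_form S k a"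
    by (simp only: lin_form_scale num_form_def power_mult_distrib)
  then show ?thesis
    unfolding b_lmmse_eq cdot_outer_lin_form by simp
qed

text \<open>Together with \<open>gamma_den_eq\<close> this identifies the trace denominator with the
  quadratic form of the Rayleigh quotient.\<close>

lemma cdot_Gamma_lmmse: "cdot a (Gamma_lmmse S k *v a) = complex_of_real (den_form S k a)"
  by (simp add: Gamma_lmmse_def matrix_vector_mult_add_rdistrib matrix_vector_mult_diff_rdistrib
      matrix_vector_mult_scaleR_left matrix_vector_mult_sum_left cdot_add_right cdot_diff_right
      cdot_scaleR_right cdot_sum_right cdot_outer_b_lmmse Gamma1_diag Gamma2_diag Omega'_diag
      cdot_diag_form cdot_outer_lin_form den_form_def T1_form_def T2_form_def ac_simps del: of_real_mult)
     (simp add: algebra_simps)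

lemma hermitian_Gamma_lmmse: "hermitian (Gamma_lmmse S k) = Gamma_lmmse S k"
  by (simp add: Gamma_lmmse_def hermitian_add hermitian_diff hermitian_scaleR hermitian_sum hermitian_outer
      Gamma1_diag Gamma2_diag Omega'_diag hermitian_diag_mat)

section \<open>Moments of the combined signal and noise\<close>

lemma combined_channel_expand:
  "cdot (lmmse S k w) (hermitian (diag_mat a) *v channel S l w)
    = (\<Sum>m\<in>UNIV. cnj (a $ m) * complex_of_real (sqrt (pilot_power S k) * beta' S m k / lambda' S m k)
        * (cnj (pilot_obs S m k w) * channel S l w $ m))"
  by (simp add: cdot_def lmmse_def hermitian_diag_mat diag_mat_mult_vec ac_simps)

lemma pilot_gain_sq:
  "(pilot_gain S k l)\<^sup>2 = (if l \<in> copilot S k then pilot_power S l * (tau_p S)\<^sup>2 else 0)"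
  using pilot_power_pos by (simp add: pilot_gain_def power_mult_distrib less_imp_le)

lemma combined_channel_mean:
  "has_bochner_integral (outcomes S)
     (\<lambda>w. cdot (lmmse S k w) (hermitian (diag_mat a) *v channel S l w))
     (complex_of_real (sqrt (pilot_power S k) * pilot_gain S k l)
       * (\<Sum>m\<in>UNIV. cnj (a $ m) * complex_of_real (cross_gain S k l m)))"
proof -
  have "has_bochner_integral (outcomes S)
     (\<lambda>w. cdot (lmmse S k w) (hermitian (diag_mat a) *v channel S l w))
     (\<Sum>m\<in>UNIV. cnj (a $ m) * complex_of_real (sqrt (pilot_power S k) * beta' S m k / lambda' S m k)
        * complex_of_real (pilot_gain S k l * beta' S m l))"
    unfolding combined_channel_expand
    by (intro has_bochner_integral_sum has_bochner_integral_mult_right pilot_obs_channel_corr)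
  then show ?thesis
    by (simp add: sum_distrib_left cross_gain_def ac_simps)
qed

lemma combined_channel_second_moment:
  "has_bochner_integral (outcomes S)
     (\<lambda>w. (cmod (cdot (lmmse S k w) (hermitian (diag_mat a) *v channel S l w)))\<^sup>2)
     (T1_form S k l a + (if l \<in> copilot S k then T2_form S k l a else 0))"
proof -
  define V where "V m w = cnj (pilot_obs S m k w) * channel S l w $ m" for m w
  define c where "c m = sqrt (pilot_power S k) * beta' S m k / lambda' S m k" for m
  define g where "g = pilot_gain S k l"
  define q where "q m = tau_p S * lambda' S m k * beta' S m l
      + g\<^sup>2 * ((beta S m l)\<^sup>2 + 2 * (hbar S m l)\<^sup>2 * beta S m l)" for m
  define e where "e m = cnj (a $ m) * complex_of_real (c m)" for m
  define \<mu> where "\<mu> m = g * beta' S m l" for m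
  have V1: "has_bochner_integral (outcomes S) (V m) (complex_of_real (\<mu> m))" for m
    using pilot_obs_channel_corr[of m k l] by (simp only: V_def [abs_def] \<mu>_def g_def)
  have V2: "has_bochner_integral (outcomes S) (\<lambda>w. V m w * cnj (V m w)) (complex_of_real (q m))" for m
    using pilot_obs_channel_second_moment[of m k l] by (simp only: V_def [abs_def] q_def g_def)
  have V12: "has_bochner_integral (outcomes S) (\<lambda>w. V m w * cnj (V n w)) (complex_of_real (\<mu> m * \<mu> n))"
    if "m \<noteq> n" for m n
  proof -
    have "indep_var borel (V m) borel (\<lambda>w. cnj (V n w))"
      using ap_indep[OF that, of k l] unfolding V_def [abs_def]
      by (rule indep_var_compose_borel[of _ _ "\<lambda>x. x"]) auto
    from indep_var_has_bochner_integral_mult[OF this V1 has_bochner_integral_cnj[OF V1]]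
    show ?thesis by simp
  qed
  have "has_bochner_integral (outcomes S) (\<lambda>w. (\<Sum>m\<in>UNIV. e m * V m w) * cnj (\<Sum>m\<in>UNIV. e m * V m w))
    (\<Sum>m\<in>UNIV. \<Sum>n\<in>UNIV. e m * cnj (e n) * complex_of_real (if m = n then q m else \<mu> m * \<mu> n))"
    using V2 V12 by (intro has_bochner_integral_sum_mult_cnj) auto
  \<comment> \<open>The off-diagonal pattern \<open>\<mu> m * \<mu> n\<close> is extended to the
    diagonal, with the variance \<open>q m - (\<mu> m)^2\<close> as correction. The full double sum
    then factors into the squared modulus of the mean.\<close>
  also have "(\<Sum>m\<in>UNIV. \<Sum>n\<in>UNIV. e m * cnj (e n) * complex_of_real (if m = n then q m else \<mu> m * \<mu> n))
    = (\<Sum>m\<in>UNIV. \<Sum>n\<in>UNIV. (if m = n then e m * cnj (e n) * complex_of_real (q m - (\<mu> m)\<^sup>2) else 0)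
          + (e m * complex_of_real (\<mu> m)) * cnj (e n * complex_of_real (\<mu> n)))"
    by (intro sum.cong refl) (auto simp: algebra_simps power2_eq_square)
  also have "\<dots> = (\<Sum>m\<in>UNIV. e m * cnj (e m) * complex_of_real (q m - (\<mu> m)\<^sup>2))
      + (\<Sum>m\<in>UNIV. e m * complex_of_real (\<mu> m)) * cnj (\<Sum>m\<in>UNIV. e m * complex_of_real (\<mu> m))"
    by (simp add: sum.distrib sum_product)
  also have "\<dots> = complex_of_real ((\<Sum>m\<in>UNIV. (cmod (e m))\<^sup>2 * (q m - (\<mu> m)\<^sup>2))
      + (cmod (\<Sum>m\<in>UNIV. e m * complex_of_real (\<mu> m)))\<^sup>2)"
    by (simp only: of_real_add of_real_sum of_real_mult complex_norm_square)
  finally have main: "has_bochner_integral (outcomes S) (\<lambda>w. (cmod (\<Sum>m\<in>UNIV. e m * V m w))\<^sup>2)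
    ((\<Sum>m\<in>UNIV. (cmod (e m))\<^sup>2 * (q m - (\<mu> m)\<^sup>2)) + (cmod (\<Sum>m\<in>UNIV. e m * complex_of_real (\<mu> m)))\<^sup>2)"
    unfolding complex_norm_square[symmetric] has_bochner_integral_of_real_iff .
  have p: "sqrt (pilot_power S k) ^ 2 = pilot_power S k"
    using pilot_power_pos by (simp add: less_imp_le)
  \<comment> \<open>The variance splits: the term of \<open>q\<close> with \<open>lambda'\<close>
    yields \<open>omega'\<close> and hence \<open>T1_form\<close>, and everything else carries the
    factor \<open>g^2\<close>, which vanishes off the pilot group.\<close>
  have "(c m)\<^sup>2 * (q m - (\<mu> m)\<^sup>2) = pilot_power S k * tau_p S * (beta' S m l * omega' S m k)
       + pilot_power S k * g\<^sup>2 * rician_excess S k l m" for m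
  proof -
    have c2: "(c m)\<^sup>2 = pilot_power S k * (beta' S m k)\<^sup>2 / (lambda' S m k)\<^sup>2"
      by (simp add: c_def power_mult_distrib power_divide p)
    show ?thesis
      unfolding c2 using lambda'_pos[of m k]
      by (simp add: q_def \<mu>_def omega'_def rician_excess_def cross_gain_def power_mult_distrib power_divide field_simps)
        (simp add: eval_nat_numeral algebra_simps)
  qed
  then have "(cmod (e m))\<^sup>2 * (q m - (\<mu> m)\<^sup>2) = pilot_power S k * tau_p S * ((cmod (a $ m))\<^sup>2 * (beta' S m l * omega' S m k))
       + pilot_power S k * g\<^sup>2 * ((cmod (a $ m))\<^sup>2 * rician_excess S k l m)" for m
    by (simp add: e_def norm_mult power_mult_distrib mult.assoc distrib_left mult.left_commute)
  then have 1: "(\<Sum>m\<in>UNIV. (cmod (e m))\<^sup>2 * (q m - (\<mu> m)\<^sup>2))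
      = T1_form S k l a + pilot_power S k * g\<^sup>2 * diag_form a (rician_excess S k l)"
    by (simp add: T1_form_def diag_form_def sum.distrib flip: sum_distrib_left)
  have "(\<Sum>m\<in>UNIV. e m * complex_of_real (\<mu> m))
      = complex_of_real (sqrt (pilot_power S k) * g) * (\<Sum>m\<in>UNIV. cnj (a $ m) * complex_of_real (cross_gain S k l m))"
    by (simp add: sum_distrib_left e_def \<mu>_def c_def cross_gain_def ac_simps)
  then have 2: "(cmod (\<Sum>m\<in>UNIV. e m * complex_of_real (\<mu> m)))\<^sup>2
      = pilot_power S k * g\<^sup>2 * lin_form a (cross_gain S k l)"
    by (simp only: norm_mult norm_of_real power_mult_distrib power2_abs lin_form_cnj p)
  have "T1_form S k l a + pilot_power S k * g\<^sup>2 * diag_form a (rician_excess S k l)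
       + pilot_power S k * g\<^sup>2 * lin_form a (cross_gain S k l)
     = T1_form S k l a + (if l \<in> copilot S k then T2_form S k l a else 0)"
    by (simp add: g_def pilot_gain_sq T2_form_def algebra_simps)
  moreover have "cdot (lmmse S k w) (hermitian (diag_mat a) *v channel S l w) = (\<Sum>m\<in>UNIV. e m * V m w)" for w
    unfolding combined_channel_expand e_def c_def V_def ..
  ultimately show ?thesis
    using main unfolding 1 2 by (simp only:)
qed

text \<open>The squared norm is a sum over access points, so only the mean power of each pilot
  observation enters. One factor \<open>lambda'\<close> cancels.\<close>

lemma combined_noise_second_moment:
  "has_bochner_integral (outcomes S) (\<lambda>w. (norm (diag_mat a *v lmmse S k w))\<^sup>2)
     (pilot_power S k * tau_p S * diag_form a (\<lambda>m. omega' S m k))"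
proof -
  have "has_bochner_integral (outcomes S)
     (\<lambda>w. \<Sum>m\<in>UNIV. (cmod (a $ m))\<^sup>2 * (pilot_power S k * (beta' S m k)\<^sup>2 / (lambda' S m k)\<^sup>2)
         * (cmod (pilot_obs S m k w))\<^sup>2)
     (\<Sum>m\<in>UNIV. (cmod (a $ m))\<^sup>2 * (pilot_power S k * (beta' S m k)\<^sup>2 / (lambda' S m k)\<^sup>2)
         * (tau_p S * lambda' S m k))"
    by (intro has_bochner_integral_sum has_bochner_integral_mult_right pilot_obs_second_moment)
  moreover have "(norm (diag_mat a *v lmmse S k w))\<^sup>2
     = (\<Sum>m\<in>UNIV. (cmod (a $ m))\<^sup>2 * (pilot_power S k * (beta' S m k)\<^sup>2 / (lambda' S m k)\<^sup>2)
         * (cmod (pilot_obs S m k w))\<^sup>2)" for w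
    using pilot_power_pos[of k]
    by (simp add: norm_vec_def L2_set_def sum_nonneg diag_mat_mult_vec lmmse_def norm_mult norm_divide
        power_mult_distrib power_divide ac_simps)
  moreover have "(cmod (a $ m))\<^sup>2 * (pilot_power S k * (beta' S m k)\<^sup>2 / (lambda' S m k)\<^sup>2)
         * (tau_p S * lambda' S m k) = pilot_power S k * tau_p S * ((cmod (a $ m))\<^sup>2 * omega' S m k)" for m
    using lambda'_pos[of m k] by (simp add: omega'_def power2_eq_square)
  ultimately show ?thesis
    by (simp add: diag_form_def flip: sum_distrib_left)
qed

lemma combined_channel_mean_sq:
  "(cmod (\<integral>w. cdot (lmmse S k w) (hermitian (diag_mat a) *v channel S k w) \<partial>outcomes S))\<^sup>2 = num_form S k a"
proof -
  have [simp]: "cross_gain S k k m = omega' S m k" for m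
    by (simp add: cross_gain_def omega'_def power2_eq_square)
  show ?thesis
    unfolding has_bochner_integral_integral_eq[OF combined_channel_mean]
    using pilot_power_pos[of k]
    by (simp only: norm_mult norm_of_real power_mult_distrib power2_abs lin_form_cnj pilot_gain_sq)
       (simp add: copilot_refl num_form_def lin_form_def power2_eq_square)
qed

lemma ul_sinr_lmmse: "ul_sinr S (lmmse S k) k a = data_power S k * num_form S k a / den_form S k a"
proof -
  have "(\<Sum>l\<in>UNIV. data_power S l * (if l \<in> copilot S k then T2_form S k l a else 0))
      = (\<Sum>l\<in>copilot S k. data_power S l * T2_form S k l a)"
    by (intro sum.mono_neutral_cong_right) auto
  then show ?thesis
    unfolding ul_sinr_def combined_channel_mean_sq
      has_bochner_integral_integral_eq[OF combined_channel_second_moment]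
      has_bochner_integral_integral_eq[OF combined_noise_second_moment]
    by (simp add: den_form_def distrib_left sum.distrib ac_simps)
qed

section \<open>Positivity of the denominator\<close>

lemma omega'_pos: "omega' S m k > 0"
  using beta'_pos[of m k] lambda'_pos[of m k] by (simp add: omega'_def)

lemma diag_form_omega'_pos: "a \<noteq> 0 \<Longrightarrow> diag_form a (\<lambda>m. omega' S m k) > 0"
proof -
  assume "a \<noteq> 0"
  then obtain m where m: "a $ m \<noteq> 0" by (auto simp: vec_eq_iff)
  show ?thesis
    unfolding diag_form_def
    by (rule sum_pos2[of _ m]) (use m omega'_pos[THEN less_imp_le] omega'_pos in auto)
qed

lemma num_form_nonneg: "num_form S k a \<ge> 0"
  by (simp add: num_form_def lin_form_def)

lemma den_form_pos:
  assumes "a \<noteq> 0"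
  shows "den_form S k a > 0"
proof -
  \<comment> \<open>The mean received power from user \<open>l\<close> after combining, nonnegative
    as the integral of a square.\<close>
  define Q where "Q l = T1_form S k l a + (if l \<in> copilot S k then T2_form S k l a else 0)" for l
  have Q: "Q l \<ge> 0" for l
    using combined_channel_second_moment[of k a l, folded Q_def]
    by (metis (no_types, lifting) has_bochner_integral_integral_eq integral_nonneg_AE AE_I2 zero_le_power2)
  have sq: "has_bochner_integral (outcomes S)
     (\<lambda>w. (cmod (cdot (lmmse S k w) (hermitian (diag_mat a) *v channel S k w)))\<^sup>2) (Q k)"
    using combined_channel_second_moment[of k a k] by (simp only: Q_def)
  have "num_form S k a \<le> Q k"
    using second_moment_ge[OF combined_channel_mean sq] combined_channel_mean_sq[of k a]
    unfolding has_bochner_integral_integral_eq[OF combined_channel_mean] by simp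
  then have "data_power S k * num_form S k a \<le> data_power S k * Q k"
    using data_power_nonneg by (intro mult_left_mono)
  \<comment> \<open>The desired user's power is one of the nonnegative summands of the total
    power.\<close>
  also have "\<dots> \<le> (\<Sum>l\<in>UNIV. data_power S l * Q l)"
    using data_power_nonneg Q by (intro member_le_sum) auto
  also have "\<dots> = (\<Sum>l\<in>UNIV. data_power S l * T1_form S k l a) + (\<Sum>l\<in>UNIV. data_power S l * (if l \<in> copilot S k then T2_form S k l a else 0))"
    by (simp add: Q_def distrib_left sum.distrib)
  also have "(\<Sum>l\<in>UNIV. data_power S l * (if l \<in> copilot S k then T2_form S k l a else 0))
      = (\<Sum>l\<in>copilot S k. data_power S l * T2_form S k l a)"
    by (intro sum.mono_neutral_cong_right) auto
  finally have "data_power S k * num_form S k a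
     \<le> (\<Sum>l\<in>UNIV. data_power S l * T1_form S k l a) + (\<Sum>l\<in>copilot S k. data_power S l * T2_form S k l a)" .
  \<comment> \<open>Strictness comes from the noise term alone: every \<open>omega'\<close> is
    positive and \<open>a\<close> has a nonzero entry.\<close>
  moreover have "sigma2 S * pilot_power S k * tau_p S * diag_form a (\<lambda>m. omega' S m k) > 0"
    using sigma2_pos pilot_power_pos tau_p_pos[of S] diag_form_omega'_pos[OF assms] by simp
  ultimately show ?thesis
    unfolding den_form_def by linarith
qed

sublocale Gamma_lmmse: pos_def "Gamma_lmmse S k" for k
  by unfold_locales (simp_all add: hermitian_Gamma_lmmse cdot_Gamma_lmmse den_form_pos)

text \<open>Guarantees that the optimal LSFD vector is nonzero and so admissible in the
  maximization.\<close>

lemma b_lmmse_neq_0: "b_lmmse S k \<noteq> 0"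
  using omega'_pos pilot_power_pos tau_p_pos[of S]
  by (auto simp: b_lmmse_eq vec_eq_iff less_imp_neq[THEN not_sym])

lemma num_form_b_lmmse: "num_form S k a = (cmod (cdot a (b_lmmse S k)))\<^sup>2"
proof -
  have "complex_of_real (num_form S k a) = cdot a (b_lmmse S k) * cnj (cdot a (b_lmmse S k))"
    by (simp add: cdot_outer cnj_cdot flip: cdot_outer_b_lmmse)
  then show ?thesis
    by (simp only: complex_norm_square[symmetric] of_real_eq_iff)
qed

end

theorem theorem2:
  fixes S :: "('m::finite, 'k::finite, 't::finite, 'w) uplink" and k :: 'k
  assumes "uplink_model S"
  shows
    "(\<forall>a. a \<noteq> 0 \<longrightarrow>
        gamma_den S k a \<noteq> 0 \<and>
        complex_of_real (ul_sinr S (lmmse S k) k a) = gamma_lmmse S k a \<and>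
        ul_se S (lmmse S k) k a
          = real (tau_u S) / real (tau_c S) * log 2 (1 + Re (gamma_lmmse S k a))) \<and>
     (\<forall>a. a \<noteq> 0 \<longrightarrow>
        cdot a (Gamma_lmmse S k *v a) \<noteq> 0 \<and>
        gamma_lmmse S k a
          = complex_of_real (data_power S k)
              * cdot a (outer (b_lmmse S k) (b_lmmse S k) *v a)
            / cdot a (Gamma_lmmse S k *v a)) \<and>
     invertible (Gamma_lmmse S k) \<and>
     is_arg_max (ul_se S (lmmse S k) k) (\<lambda>a. a \<noteq> 0)
       (matrix_inv (Gamma_lmmse S k) *v b_lmmse S k) \<and>
     cdot (b_lmmse S k) (matrix_inv (Gamma_lmmse S k) *v b_lmmse S k) \<in> \<real> \<and>
     ul_se S (lmmse S k) k (matrix_inv (Gamma_lmmse S k) *v b_lmmse S k)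
       = real (tau_u S) / real (tau_c S)
           * log 2 (1 + data_power S k
               * Re (cdot (b_lmmse S k) (matrix_inv (Gamma_lmmse S k) *v b_lmmse S k)))"
proof -
  interpret uplink_model S by fact
  define G where "G = Gamma_lmmse S k"
  define b where "b = b_lmmse S k"
  define a' where "a' = matrix_inv G *v b"
  define \<beta> where "\<beta> = Re (cdot b a')"
  have sinr: "complex_of_real (ul_sinr S (lmmse S k) k a) = gamma_lmmse S k a" for a
    by (simp add: gamma_lmmse_def gamma_num_eq gamma_den_eq ul_sinr_lmmse)
  have a': "a' \<noteq> 0"
    unfolding a'_def b_def G_def by (intro Gamma_lmmse.matrix_inv_neq_0 b_lmmse_neq_0)
  have den: "den_form S k a = Re (cdot a (G *v a))" for a
    by (simp add: G_def cdot_Gamma_lmmse)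
  have le: "num_form S k a / den_form S k a \<le> \<beta>" if "a \<noteq> 0" for a
    unfolding den num_form_b_lmmse \<beta>_def a'_def G_def b_def
    by (rule Gamma_lmmse.Rayleigh_le[OF that])
  have real: "cdot b a' = complex_of_real \<beta>"
    unfolding \<beta>_def using Gamma_lmmse.form_inv_real[where b = b and k = k]
    by (simp add: a'_def G_def of_real_Re)
  \<comment> \<open>At \<open>a'\<close> the bound \<open>le\<close> is attained: the denominator is
    \<open>cdot a' b\<close>, equal to the real number \<open>\<beta>\<close>, and the numerator is
    its square.\<close>
  have "cdot a' (G *v a') = cdot a' b"
    by (simp add: a'_def G_def Gamma_lmmse.mult_matrix_inv)
  also have a'b: "cdot a' b = complex_of_real \<beta>"
    using real by (metis cnj_cdot complex_cnj_complex_of_real)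
  finally have "den_form S k a' = \<beta>"
    by (simp add: den)
  moreover have "num_form S k a' = \<beta>\<^sup>2"
    by (simp add: num_form_b_lmmse a'b flip: b_def)
  ultimately have eq: "num_form S k a' / den_form S k a' = \<beta>"
    using den_form_pos[OF a', of k] by (simp add: power2_eq_square)
  have sinr_eq: "ul_sinr S (lmmse S k) k a' = data_power S k * \<beta>"
    unfolding ul_sinr_lmmse times_divide_eq_right[symmetric] eq ..
  have sinr_nonneg: "ul_sinr S (lmmse S k) k a \<ge> 0" if "a \<noteq> 0" for a
    unfolding ul_sinr_lmmse using num_form_nonneg den_form_pos[OF that, of k] data_power_nonneg
    by simp
  have "ul_sinr S (lmmse S k) k a \<le> ul_sinr S (lmmse S k) k a'" if "a \<noteq> 0" for a
    unfolding sinr_eq unfolding ul_sinr_lmmse times_divide_eq_right[symmetric]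
    by (intro mult_left_mono le that data_power_nonneg)
  \<comment> \<open>Nonnegative SINRs keep the arguments of the logarithm positive, so its
    monotonicity carries the SINR comparison over to the spectral efficiency.\<close>
  then have "ul_se S (lmmse S k) k a \<le> ul_se S (lmmse S k) k a'" if "a \<noteq> 0" for a
    unfolding ul_se_def using that sinr_nonneg[OF that] sinr_nonneg[OF a']
    by (intro mult_left_mono) (auto simp: add_pos_nonneg)
  then have max: "is_arg_max (ul_se S (lmmse S k) k) (\<lambda>a. a \<noteq> 0) a'"
    using a' by (auto simp: is_arg_max_def not_less)
  show ?thesis
    unfolding G_def[symmetric] b_def[symmetric] a'_def[symmetric] \<beta>_def[symmetric]
  proof (intro conjI allI impI)
    fix a :: "complex^'m" assume a: "a \<noteq> 0"
    note pos = den_form_pos[OF a, of k]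
    show "gamma_den S k a \<noteq> 0"
      using pos by (simp add: gamma_den_eq)
    show "complex_of_real (ul_sinr S (lmmse S k) k a) = gamma_lmmse S k a"
      by (rule sinr)
    show "ul_se S (lmmse S k) k a = real (tau_u S) / real (tau_c S) * log 2 (1 + Re (gamma_lmmse S k a))"
      by (simp add: ul_se_def flip: sinr)
    show "cdot a (G *v a) \<noteq> 0"
      using pos by (simp add: G_def cdot_Gamma_lmmse)
    show "gamma_lmmse S k a = complex_of_real (data_power S k) * cdot a (outer b b *v a) / cdot a (G *v a)"
      by (simp add: gamma_lmmse_def gamma_num_eq gamma_den_eq G_def b_def cdot_Gamma_lmmse cdot_outer_b_lmmse)
  next
    show "invertible G"
      unfolding G_def by (rule Gamma_lmmse.invertible)
    show "is_arg_max (ul_se S (lmmse S k) k) (\<lambda>a. a \<noteq> 0) a'"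
      by (rule max)
    show "cdot b a' \<in> \<real>"
      by (simp add: real)
    show "ul_se S (lmmse S k) k a' = real (tau_u S) / real (tau_c S) * log 2 (1 + data_power S k * \<beta>)"
      by (simp add: ul_se_def sinr_eq)
  qed
qed

end
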